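(* Let $\mathbb{K}$ be an algebraically closed field of characteristic different from $2$ and $3$. Each PBW deformation of $B$ in the category of $G$-modules is of the form $\mathcal{T}(\alpha_1,\alpha_2,\alpha_3)$ for some $\alpha_1,\alpha_2,\alpha_3\in\mathbb{K}$ (that is, it is isomorphic to such an algebra, as a filtered algebra in the category of $G$-modules).
   Context: $G$ is the group given by generators $g_a,g_b,g_c,g_d$ and relations $$g_ag_b=g_bg_c=g_cg_a,\quad g_ag_c=g_cg_d=g_dg_a,\quad g_ag_d=g_dg_b=g_bg_a,\quad g_bg_d=g_dg_c=g_cg_b.$$ $\mathcal{T}(\alpha_1,\alpha_2,\alpha_3)$ denotes the associative unital $\mathbb{K}$-algebra given by generators $a,b,c,d$ and relations $$a^2=b^2=c^2=d^2=\alpha_1,$$ $$ca+bc+ab=\alpha_2,\quad da+cd+ac=\alpha_2,\quad db+ba+ad=\alpha_2,\quad dc+cb+bd=\alpha_2,$$ $$(cb+ba+ac-\alpha_2)^3=\alpha_3,$$ filtered by degree in the generators (the $m$-th piece is spanned by words of length at most $m$ in $a,b,c,d$). $B$ denotes the associative unital $\mathbb{K}$-algebra given by generators $a,b,c,d$ and relations $$a^2=b^2=c^2=d^2=0,$$ $$ab+bc+ca=0,\quad ac+cd+da=0,\quad ad+ba+db=0,\quad bd+cb+dc=0,\quad (a+b+c)^6=0,$$ $\mathbb{N}_0$-graded with $a,b,c,d$ in degree $1$. The group $G$ acts by algebra automorphisms on $B$ and on each $\mathcal{T}(\alpha_1,\alpha_2,\alpha_3)$; the action on the generators $(a,b,c,d)$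 is $$g_a\colon (a,b,c,d)\mapsto(-a,-c,-d,-b),\qquad g_b\colon (a,b,c,d)\mapsto(-d,-b,-a,-c),$$ $$g_c\colon (a,b,c,d)\mapsto(-b,-d,-c,-a),\qquad g_d\colon (a,b,c,d)\mapsto(-c,-a,-b,-d).$$ Let $\mathcal{C}$ be a monoidal category (here: the category of $\mathbb{K}G$-modules) and let $A$ be an $\mathbb{N}_0$-graded algebra in $\mathcal{C}$. A PBW deformation of $A$ in $\mathcal{C}$ is an $\mathbb{N}_0$-filtered algebra $D$ in $\mathcal{C}$ such that $\mathrm{gr}\,D\cong A$ (as graded algebras in $\mathcal{C}$). *)

theory Defs
  imports
    "HOL-Library.Poly_Mapping"
    "HOL-Algebra.Algebra"
    "HOL-Algebra.Algebraic_Closure_Type"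
begin

section \<open>The group $G$\<close>

datatype letter = La | Lb | Lc | Ld

text \<open>
  A group word is a list of letters with exponents: \<open>(x, True)\<close> stands for the generator \<open>g\<^sub>x\<close>
  and \<open>(x, False)\<close> for its inverse.
\<close>

type_synonym gword = "(letter \<times> bool) list"

abbreviation (input) two :: "letter \<Rightarrow> letter \<Rightarrow> gword" where
  "two x y \<equiv> [(x, True), (y, True)]"

definition group_rels :: "(gword \<times> gword) set" where
  "group_rels =
    {(two La Lb, two Lb Lc), (two Lb Lc, two Lc La),
     (two La Lc, two Lc Ld), (two Lc Ld, two Ld La),
     (two La Ld, two Ld Lb), (two Ld Lb, two Lb La),
     (two Lb Ld, two Ld Lc), (two Ld Lc, two Lc Lb)}"

inductive gword_eq :: "gword \<Rightarrow> gword \<Rightarrow> bool" where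
  refl: "gword_eq u u"
| sym: "gword_eq u v \<Longrightarrow> gword_eq v u"
| trans: "gword_eq u v \<Longrightarrow> gword_eq v w \<Longrightarrow> gword_eq u w"
| cong: "gword_eq u v \<Longrightarrow> gword_eq u' v' \<Longrightarrow> gword_eq (u @ u') (v @ v')"
| cancel: "gword_eq [(x, s), (x, \<not> s)] []"
| rel: "(u, v) \<in> group_rels \<Longrightarrow> gword_eq u v"

quotient_type tgroup = gword / gword_eq
  by (rule equivpI) (auto intro!: reflpI sympI transpI intro: gword_eq.refl gword_eq.sym gword_eq.trans)

lift_definition tgroup_mult :: "tgroup \<Rightarrow> tgroup \<Rightarrow> tgroup" is "(@)"
  by (rule gword_eq.cong)

lift_definition tgroup_one :: tgroup is "[]" .

definition tetG :: "tgroup monoid" where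
  "tetG = \<lparr>carrier = UNIV, monoid.mult = tgroup_mult, one = tgroup_one\<rparr>"

lift_definition gg :: "letter \<Rightarrow> tgroup" is "\<lambda>x. [(x, True)]" .

lemma gword_inverse: "gword_eq (rev (map (apsnd Not) w) @ w) []"
proof (induction w)
  case (Cons p w)
  obtain x s where p: "p = (x, s)" by fastforce
  have *: "gword_eq [(x, \<not> s), (x, s)] []"
    using gword_eq.cancel[of x "\<not> s"] by simp
  have "gword_eq (rev (map (apsnd Not) w) @ ([(x, \<not> s), (x, s)] @ w))
                 (rev (map (apsnd Not) w) @ ([] @ w))"
    by (intro gword_eq.cong gword_eq.refl *)
  with Cons.IH show ?case by (auto simp: p intro: gword_eq.trans)
qed (auto intro: gword_eq.refl)

lemma group_tetG: "group tetG"
proof (rule groupI)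
  fix x assume "x \<in> carrier tetG"
  have "\<exists>y. tgroup_mult y x = tgroup_one"
    by transfer (use gword_inverse in blast)
  then show "\<exists>y\<in>carrier tetG. y \<otimes>\<^bsub>tetG\<^esub> x = \<one>\<^bsub>tetG\<^esub>"
    by (simp add: tetG_def)
qed (simp_all add: tetG_def, (transfer, simp add: gword_eq.refl)+)

text \<open>
  Every element of $G$ acts on the span of the letters by a sign times a permutation of the letters.
  The generators \<open>g\<^sub>x\<close> act by \<open>y \<mapsto> - letter_perm x y\<close>.
\<close>

fun letter_perm :: "letter \<Rightarrow> letter \<Rightarrow> letter" where
  "letter_perm La La = La" | "letter_perm La Lb = Lc" | "letter_perm La Lc = Ld" | "letter_perm La Ld = Lb"
| "letter_perm Lb La = Ld" | "letter_perm Lb Lb = Lb" | "letter_perm Lb Lc = La" | "letter_perm Lb Ld = Lc"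
| "letter_perm Lc La = Lb" | "letter_perm Lc Lb = Ld" | "letter_perm Lc Lc = Lc" | "letter_perm Lc Ld = La"
| "letter_perm Ld La = Lc" | "letter_perm Ld Lb = La" | "letter_perm Ld Lc = Lb" | "letter_perm Ld Ld = Ld"

lemma bij_letter_perm: "bij (letter_perm x)"
proof (rule o_bij)
  let ?f = "letter_perm x \<circ> letter_perm x"
  have "letter_perm x (?f y) = y" for y by (cases x; cases y) simp_all
  then show "?f \<circ> letter_perm x = id" "letter_perm x \<circ> ?f = id" by (auto simp: fun_eq_iff)
qed

fun gword_perm :: "gword \<Rightarrow> letter \<Rightarrow> letter" where
  "gword_perm [] = id"
| "gword_perm ((x, s) # w) = (if s then letter_perm x else inv_into UNIV (letter_perm x)) \<circ> gword_perm w"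

lemma gword_perm_append: "gword_perm (u @ v) = gword_perm u \<circ> gword_perm v"
  by (induction u) (auto simp: fun_eq_iff)

lift_definition gperm :: "tgroup \<Rightarrow> letter \<Rightarrow> letter" is gword_perm
proof -
  fix u v assume "gword_eq u v"
  then show "gword_perm u = gword_perm v"
  proof induction
    case (cancel x s)
    then show ?case
      by (auto simp: fun_eq_iff inv_f_f[OF bij_is_inj[OF bij_letter_perm]]
            surj_f_inv_f[OF bij_is_surj[OF bij_letter_perm]])
  next
    case (rel u v)
    have "gword_perm u y = gword_perm v y" for y
      using rel by (cases y) (auto simp: group_rels_def)
    then show ?case by auto
  qed (auto simp: gword_perm_append)
qed

lift_definition gsign :: "tgroup \<Rightarrow> int" is "\<lambda>w. (-1) ^ length w"
proof -
  fix u v assume "gword_eq u v"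
  then show "(- 1 :: int) ^ length u = (- 1) ^ length v"
    by induction (auto simp: group_rels_def power_add)
qed

section \<open>The free algebra on $a,b,c,d$\<close>

text \<open>
  Words form the free monoid, written additively so that finitely supported functions on words
  become the monoid algebra of \<^theory>\<open>HOL-Library.Poly_Mapping\<close>.
\<close>

datatype word = Word (letters: "letter list")

instantiation word :: monoid_add
begin
definition zero_word :: word where "0 = Word []"
definition plus_word :: "word \<Rightarrow> word \<Rightarrow> word" where "u + v = Word (letters u @ letters v)"
instance by standard (simp_all add: zero_word_def plus_word_def)
end

type_synonym 'k free = "word \<Rightarrow>\<^sub>0 'k"

definition gen :: "letter \<Rightarrow> 'k::field free" where
  "gen x = Poly_Mapping.single (Word [x]) 1"

definition const :: "'k::field \<Rightarrow> 'k free" where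
  "const r = Poly_Mapping.single 0 r"

definition subst :: "(letter \<Rightarrow> 'k::field free) \<Rightarrow> 'k free \<Rightarrow> 'k free" where
  "subst \<sigma> f =
    (\<Sum>w\<in>Poly_Mapping.keys f. const (Poly_Mapping.lookup f w) * prod_list (map \<sigma> (letters w)))"

definition free_act :: "tgroup \<Rightarrow> 'k::field free \<Rightarrow> 'k free" where
  "free_act g = subst (\<lambda>x. of_int (gsign g) * gen (gperm g x))"

definition homogeneous :: "nat \<Rightarrow> 'k::field free set" where
  "homogeneous m = {f. \<forall>w\<in>Poly_Mapping.keys f. length (letters w) = m}"

definition degree_le :: "nat \<Rightarrow> 'k::field free set" where
  "degree_le m = {f. \<forall>w\<in>Poly_Mapping.keys f. length (letters w) \<le> m}"

section \<open>Filtered and graded algebras in the category of $G$-modules\<close>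

text \<open>
  The field \<open>piece\<close> holds the homogeneous components of a graded algebra, respectively the
  filtration of a filtered algebra.
\<close>

record ('k, 'a) galgebra = "('k, 'a) module" +
  act :: "tgroup \<Rightarrow> 'a \<Rightarrow> 'a"
  piece :: "nat \<Rightarrow> 'a set"

locale G_algebra = ring A + module ring_of_type_algebra A
  for A :: "('k::field, 'a) galgebra" (structure) +
  assumes smult_mult_left:
      "x \<in> carrier A \<Longrightarrow> y \<in> carrier A \<Longrightarrow> (r \<odot> x) \<otimes> y = r \<odot> (x \<otimes> y)"
    and smult_mult_right:
      "x \<in> carrier A \<Longrightarrow> y \<in> carrier A \<Longrightarrow> x \<otimes> (r \<odot> y) = r \<odot> (x \<otimes> y)"
    and group_action: "group_action tetG (carrier A) (\<lambda>g. restrict (act A g) (carrier A))"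
    and act_ring_hom: "act A g \<in> ring_hom A A"
    and act_smult: "x \<in> carrier A \<Longrightarrow> act A g (r \<odot> x) = r \<odot> act A g x"

locale filtered_G_algebra = G_algebra +
  assumes piece_submodule: "submodule (piece A m) ring_of_type_algebra A"
    and piece_act: "x \<in> piece A m \<Longrightarrow> act A g x \<in> piece A m"
    and piece_mono: "m \<le> n \<Longrightarrow> piece A m \<subseteq> piece A n"
    and piece_exhaustive: "(\<Union>m. piece A m) = carrier A"
    and piece_one: "\<one> \<in> piece A 0"
    and piece_mult: "x \<in> piece A m \<Longrightarrow> y \<in> piece A n \<Longrightarrow> x \<otimes> y \<in> piece A (m + n)"

text \<open>
  The same notion of isomorphism serves for graded and for filtered algebras, since \<open>\<phi>\<close> has to map
  each piece onto the corresponding piece.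
\<close>

definition galgebra_iso :: "('k::field, 'a) galgebra \<Rightarrow> ('k, 'b) galgebra \<Rightarrow> bool" where
  "galgebra_iso A B \<longleftrightarrow>
    (\<exists>\<phi>\<in>ring_iso A B.
      (\<forall>r. \<forall>x\<in>carrier A. \<phi> (r \<odot>\<^bsub>A\<^esub> x) = r \<odot>\<^bsub>B\<^esub> \<phi> x) \<and>
      (\<forall>g. \<forall>x\<in>carrier A. \<phi> (act A g x) = act B g (\<phi> x)) \<and>
      (\<forall>m. \<phi> ` piece A m = piece B m))"

text \<open>
  The map that \<open>h\<close> induces from cosets (of any subgroup that \<open>h\<close> maps into \<open>I\<close>) to cosets of \<open>I\<close>.
\<close>

definition induced :: "('a, 'm) ring_scheme \<Rightarrow> 'a set \<Rightarrow> ('a \<Rightarrow> 'a) \<Rightarrow> 'a set \<Rightarrow> 'a set" where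
  "induced R I h C = (\<Union>x\<in>C. I +>\<^bsub>R\<^esub> h x)"

subsection \<open>The associated graded algebra\<close>

definition lower :: "('k::field, 'a) galgebra \<Rightarrow> nat \<Rightarrow> 'a set" where
  "lower D m = (case m of 0 \<Rightarrow> {\<zero>\<^bsub>D\<^esub>} | Suc n \<Rightarrow> piece D n)"

definition gr_comp :: "('k::field, 'a) galgebra \<Rightarrow> nat \<Rightarrow> 'a set monoid" where
  "gr_comp D m = (add_monoid D)\<lparr>carrier := piece D m\<rparr> Mod lower D m"

definition gr_times :: "('k::field, 'a) galgebra \<Rightarrow> nat \<Rightarrow> nat \<Rightarrow> 'a set \<Rightarrow> 'a set \<Rightarrow> 'a set" where
  "gr_times D i j C C' = (\<Union>x\<in>C. \<Union>y\<in>C'. lower D (i + j) +>\<^bsub>D\<^esub> (x \<otimes>\<^bsub>D\<^esub> y))"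

text \<open>
  The underlying additive group is the external direct sum of the groups \<open>gr_comp D m\<close>; note that
  these are written multiplicatively, so \<open>finprod\<close> is the sum in \<open>gr_comp D m\<close>.
\<close>

definition gr :: "('k::field, 'a) galgebra \<Rightarrow> ('k, nat \<Rightarrow> 'a set) galgebra" where
  "gr D =
    \<lparr>carrier = carrier (sum_group UNIV (gr_comp D)),
     monoid.mult =
       (\<lambda>f f' m. finprod (gr_comp D m) (\<lambda>i. gr_times D i (m - i) (f i) (f' (m - i))) {..m}),
     one = (\<lambda>m. if m = 0 then lower D 0 +>\<^bsub>D\<^esub> \<one>\<^bsub>D\<^esub> else lower D m),
     ring.zero = one (sum_group UNIV (gr_comp D)),
     add = monoid.mult (sum_group UNIV (gr_comp D)),
     module.smult = (\<lambda>r f m. induced D (lower D m) (\<lambda>x. r \<odot>\<^bsub>D\<^esub> x) (f m)),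
     act = (\<lambda>g f m. induced D (lower D m) (act D g) (f m)),
     piece = (\<lambda>m. {f \<in> carrier (sum_group UNIV (gr_comp D)). \<forall>n. n \<noteq> m \<longrightarrow> f n = lower D n})\<rparr>"

definition PBW_deformation :: "('k::field, 'a) galgebra \<Rightarrow> ('k, 'b) galgebra \<Rightarrow> bool" where
  "PBW_deformation D A \<longleftrightarrow> filtered_G_algebra D \<and> galgebra_iso (gr D) A"

section \<open>The algebras $B$ and $T(\alpha_1,\alpha_2,\alpha_3)$\<close>

text \<open>
  The quotient of the free algebra by the two-sided ideal generated by \<open>S\<close>, with the \<open>G\<close>-action
  induced by \<^const>\<open>free_act\<close> (the ideals used below are stable under it); its \<open>m\<close>-th piece is the image of \<open>P m\<close>.
\<close>

definition presented ::
  "'k::field free set \<Rightarrow> (nat \<Rightarrow> 'k free set) \<Rightarrow> ('k, 'k free set) galgebra" where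
  "presented S P =
    (let R = ring_of_type_algebra; I = genideal R S; Q = R Quot I in
      \<lparr>carrier = carrier Q, monoid.mult = monoid.mult Q, one = one Q, ring.zero = ring.zero Q, add = add Q,
       module.smult = (\<lambda>r. induced R I (\<lambda>f. const r * f)),
       act = (\<lambda>g. induced R I (free_act g)),
       piece = (\<lambda>m. (\<lambda>f. I +>\<^bsub>R\<^esub> f) ` P m)\<rparr>)"

definition T_alg :: "'k::field \<Rightarrow> 'k \<Rightarrow> 'k \<Rightarrow> ('k, 'k free set) galgebra" where
  "T_alg \<alpha>1 \<alpha>2 \<alpha>3 =
    (let a = gen La; b = gen Lb; c = gen Lc; d = gen Ld in
      presented
       {a\<^sup>2 - const \<alpha>1, b\<^sup>2 - const \<alpha>1, c\<^sup>2 - const \<alpha>1, d\<^sup>2 - const \<alpha>1,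
        c * a + b * c + a * b - const \<alpha>2,
        d * a + c * d + a * c - const \<alpha>2,
        d * b + b * a + a * d - const \<alpha>2,
        d * c + c * b + b * d - const \<alpha>2,
        (c * b + b * a + a * c - const \<alpha>2) ^ 3 - const \<alpha>3}
       degree_le)"

definition B_alg :: "('k::field, 'k free set) galgebra" where
  "B_alg =
    (let a = gen La; b = gen Lb; c = gen Lc; d = gen Ld in
      presented
       {a\<^sup>2, b\<^sup>2, c\<^sup>2, d\<^sup>2,
        a * b + b * c + c * a,
        a * c + c * d + d * a,
        a * d + b * a + d * b,
        b * d + c * b + d * c,
        (a + b + c) ^ 6}
       homogeneous)"

end

theory Submission
  imports Defs
begin

text \<open>
  In a PBW deformation \<open>D\<close> the letters have unique lifts that \<open>gg x\<close> negates as it negates the letter \<open>x\<close>; they make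
  \<open>D\<close> an equivariant quotient of the free algebra by an ideal \<open>K\<close> with the same leading terms as the
  ideal of $B$. Since \<open>- 1\<close> acts on the letters through $G$, the quadratic relations can only be deformed by
  constants, which gives \<open>\<alpha>1\<close> and \<open>\<alpha>2\<close>. Modulo these relations the elements $Z_x$, with
  $Z_d = cb + ba + ac - \alpha_2$, satisfy the relations of $G$ and add up to zero; this forces
  $Z_a^3 = Z_b^3 = Z_c^3 = Z_d^3$, so that $Z_d^3$ is $G$-invariant and commutes with $d$. The last relation
  expresses $Z_d^3$ by an element of degree at most 5, which may be averaged over $G$. Up to scalars the
  averages form one line modulo lower terms, spanned by the average of $abac$. This average does not commute with $d$
  in degree 5 of $B$, as a representation of the quadratic relations shows, so $Z_d^3$ is a constant \<open>\<alpha>3\<close>.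
\<close>

section \<open>The free algebra\<close>

text \<open>The obstacle is that the lower part \<open>h\<close> of the lifted relation $(a+b+c)^6 +
  h$ is unknown: a priori it involves every word of length at most 5. The link with $Z_d$ is that
  $(a+b+c)^2$ equals $Z_d$ plus a constant modulo the quadratic relations, so the lifted relation
  becomes one for $Z_d^3$. As $Z_d^3$ is fixed by the letter permutations and by the sign, applying
  these and adding up changes only the right-hand side. The sign removes words of odd length, where
  2 is divided out; the twelve even permutations identify words up to relabelling, and 12 is divided
  out at the end. Let $J$ be the ideal generated by the relations of $T$. Once these lie in $K$,
  equality of $J$ and $K$ follows by descent on the degree: leading forms of $K$ lie in the ideal of
  $B$, and every homogeneous element of that ideal is a leading form of $J$. What has to be known
  about $B$ itself is thus a single non-vanishing in degree 5. A matrix coefficient of a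
  representation of the quadratic relations detects it; cutting it off at length 5 makes it vanish
  on the sixth power.\<close>

lemma free_induct [case_names single add]:
  assumes single: "\<And>w r. P (Poly_Mapping.single w r)"
    and add: "\<And>f g. P f \<Longrightarrow> P g \<Longrightarrow> P (f + g)"
  shows "P (f :: 'a \<Rightarrow>\<^sub>0 'b::comm_monoid_add)"
proof (induction f rule: update_induct)
  case const
  show ?case using single[of undefined 0] by simp
next
  case (update f a b)
  have "Poly_Mapping.update a b f = Poly_Mapping.single a b + f"
    using update by (intro poly_mapping_eqI) (auto simp: lookup_update lookup_add lookup_single in_keys_iff)
  then show ?case using add[OF single update(3)] by simp
qed

abbreviation wd :: "letter list \<Rightarrow> 'k::field free" where
  "wd l \<equiv> Poly_Mapping.single (Word l) 1"

lemma Word_add [simp]: "Word l + Word l' = Word (l @ l')"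
  by (simp add: plus_word_def)

lemma zero_eq_Word: "0 = Word []"
  by (simp add: zero_word_def)

lemma letters_zero [simp]: "letters 0 = []"
  by (simp add: zero_word_def)

lemma letters_add [simp]: "letters (u + v) = letters u @ letters v"
  by (simp add: plus_word_def)

lemma const_0 [simp]: "const 0 = 0" and const_1 [simp]: "const 1 = 1"
  by (simp_all add: const_def)

lemma const_add: "const (r + s) = const r + const s"
  and const_diff: "const (r - s) = const r - const s"
  and const_minus: "const (- r) = - const r"
  by (simp_all add: const_def single_add single_diff single_uminus)

lemma const_mult: "const (r * s) = const r * const s"
  by (simp add: const_def mult_single)

lemma const_numeral [simp]: "const (numeral n) = numeral n"
  by (simp add: const_def)

lemma const_mult_single: "const r * Poly_Mapping.single w s = Poly_Mapping.single w (r * s)"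
  and single_mult_const: "Poly_Mapping.single w s * const r = Poly_Mapping.single w (s * r)"
  by (simp_all add: const_def mult_single)

lemma const_commute: "f * const r = const r * f"
proof (induction f rule: free_induct)
  case (single w s)
  then show ?case by (simp add: const_mult_single single_mult_const mult.commute)
qed (simp add: distrib_left distrib_right)

lemma const_left_commute: "f * (const r * g) = const r * (f * g)"
  by (metis const_commute mult.assoc)

lemma gen_eq_wd: "gen x = wd [x]"
  by (simp add: gen_def)

lemma wd_mult: "wd l * wd l' = wd (l @ l')"
  by (simp add: mult_single)

lemma wd_Nil: "wd [] = 1"
  by (metis single_one zero_eq_Word)

lemma wd_Cons: "wd (x # l) = gen x * wd l"
  by (simp add: gen_def mult_single)

lemma single_Word: "Poly_Mapping.single w r = const r * wd (letters w)"
  by (cases w) (simp add: const_mult_single)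

subsection \<open>Substitution\<close>

text \<open>Sums over different supports become comparable over one finite set containing them all;
  \<open>lin\<close> and \<open>ev\<close> are treated in the same way.\<close>

lemma subst_superset:
  assumes "finite W" "Poly_Mapping.keys f \<subseteq> W"
  shows "subst \<sigma> f = (\<Sum>w\<in>W. const (Poly_Mapping.lookup f w) * prod_list (map \<sigma> (letters w)))"
  unfolding subst_def using assms by (intro sum.mono_neutral_left) (auto simp: in_keys_iff)

lemma subst_add: "subst \<sigma> (f + g) = subst \<sigma> f + subst \<sigma> g"
proof -
  define W where "W = Poly_Mapping.keys f \<union> Poly_Mapping.keys g"
  have W: "finite W" "Poly_Mapping.keys f \<subseteq> W" "Poly_Mapping.keys g \<subseteq> W" "Poly_Mapping.keys (f + g) \<subseteq> W"
    using keys_add[of f g] by (simp_all add: W_def)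
  show ?thesis
    unfolding W(2-4)[THEN subst_superset[OF W(1)]] lookup_add const_add distrib_right sum.distrib ..
qed

lemma subst_single: "subst \<sigma> (Poly_Mapping.single w r) = const r * prod_list (map \<sigma> (letters w))"
  by (subst subst_superset[of "{w}"]) auto

lemma subst_const [simp]: "subst \<sigma> (const r) = const r"
  using subst_single[of \<sigma> 0 r] by (simp flip: const_def)

lemma subst_0 [simp]: "subst \<sigma> 0 = 0" and subst_1 [simp]: "subst \<sigma> 1 = 1"
  using subst_const[of \<sigma> 0] subst_const[of \<sigma> 1] by simp_all

lemma subst_gen [simp]: "subst \<sigma> (gen x) = \<sigma> x"
  by (simp add: gen_def subst_single)

lemma subst_mult: "subst \<sigma> (f * g) = subst \<sigma> f * subst \<sigma> g"
proof (induction f rule: free_induct)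
  case (single u r)
  show ?case
  proof (induction g rule: free_induct)
    case (single v s)
    show ?case
      unfolding mult_single subst_single const_mult letters_add map_append prod_list.append mult.assoc
        const_left_commute[of _ s] ..
  qed (simp add: distrib_left subst_add)
qed (simp add: distrib_right subst_add)

lemma subst_minus: "subst \<sigma> (- f) = - subst \<sigma> f"
  by (metis add.right_inverse minus_unique subst_0 subst_add)

lemma subst_diff: "subst \<sigma> (f - g) = subst \<sigma> f - subst \<sigma> g"
  using subst_add[of \<sigma> f "- g"] by (simp add: subst_minus)

lemma subst_sum: "subst \<sigma> (sum h A) = (\<Sum>x\<in>A. subst \<sigma> (h x))"
  by (induction A rule: infinite_finite_induct) (simp_all add: subst_add)

lemma subst_power: "subst \<sigma> (f ^ n) = subst \<sigma> f ^ n"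
  by (induction n) (simp_all add: subst_mult)

lemma subst_prod_list: "subst \<sigma> (prod_list fs) = prod_list (map (subst \<sigma>) fs)"
  by (induction fs) (simp_all add: subst_mult)

lemma subst_subst: "subst \<sigma> (subst \<tau> f) = subst (\<lambda>x. subst \<sigma> (\<tau> x)) f"
proof (induction f rule: free_induct)
  case (single w r)
  then show ?case by (simp add: subst_single subst_mult subst_prod_list comp_def)
qed (simp add: subst_add)

lemma subst_gen_id: "subst gen f = (f :: 'b::field free)"
proof (induction f rule: free_induct)
  case (single w r)
  have "prod_list (map gen l) = (wd l :: 'b free)" for l by (induction l) (simp_all only: list.map prod_list.Nil prod_list.Cons wd_Nil wd_Cons)
  then show ?case by (simp add: subst_single const_mult_single)
qed (simp add: subst_add)

abbreviation relabel :: "(letter \<Rightarrow> letter) \<Rightarrow> 'k::field free \<Rightarrow> 'k free" where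
  "relabel \<pi> \<equiv> subst (\<lambda>x. gen (\<pi> x))"

abbreviation negate :: "'k::field free \<Rightarrow> 'k free" where
  "negate \<equiv> subst (\<lambda>x. - gen x)"

lemma relabel_wd [simp]: "relabel \<pi> (wd l) = wd (map \<pi> l)"
  by (induction l) (simp_all only: wd_Nil wd_Cons subst_mult subst_gen subst_1 list.map)

lemma relabel_relabel: "relabel \<pi> (relabel \<rho> f) = relabel (\<pi> \<circ> \<rho>) f"
  by (simp add: subst_subst)

lemma negate_wd: "negate (wd l) = (- 1) ^ length l * wd l"
  by (induction l) (simp_all add: wd_Nil wd_Cons subst_mult minus_one_power_iff)

lemma free_act_gg: "free_act (gg x) = subst (\<lambda>y. - gen (letter_perm x y))"
proof -
  have "gsign (gg x) = - 1" "gperm (gg x) = letter_perm x"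
    by (transfer, simp)+
  then show ?thesis by (simp add: free_act_def)
qed

subsection \<open>Degrees\<close>

lift_definition restrict_words :: "(word \<Rightarrow> bool) \<Rightarrow> 'k::field free \<Rightarrow> 'k free"
  is "\<lambda>Q f w. if Q w then f w else 0"
  by (rule finite_subset) auto

abbreviation component :: "nat \<Rightarrow> 'k::field free \<Rightarrow> 'k free" where
  "component m \<equiv> restrict_words (\<lambda>w. length (letters w) = m)"

text \<open>The strict bound mirrors \<open>lower\<close>: degree 0 leaves only zero, and evaluation
  at the lifts will send \<open>degree_less m\<close> onto \<open>lower A m\<close>.\<close>

definition degree_less :: "nat \<Rightarrow> 'k::field free set" where
  "degree_less m = {f. \<forall>w\<in>Poly_Mapping.keys f. length (letters w) < m}"

lemma restrict_words_add: "restrict_words Q (f + g) = restrict_words Q f + restrict_words Q g"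
  by (intro poly_mapping_eqI) (simp add: restrict_words.rep_eq lookup_add)

lemma restrict_words_0 [simp]: "restrict_words Q 0 = 0"
  by (intro poly_mapping_eqI) (simp add: restrict_words.rep_eq)

lemma restrict_words_single:
  "restrict_words Q (Poly_Mapping.single w r) = (if Q w then Poly_Mapping.single w r else 0)"
  by (intro poly_mapping_eqI) (auto simp: restrict_words.rep_eq lookup_single when_def)

lemma keys_restrict_words: "Poly_Mapping.keys (restrict_words Q f) = {w \<in> Poly_Mapping.keys f. Q w}"
  by (auto simp: in_keys_iff restrict_words.rep_eq split: if_splits)

lemma keys_diff_free: "Poly_Mapping.keys (f - g) \<subseteq> Poly_Mapping.keys f \<union> Poly_Mapping.keys (g :: 'k::field free)"
  by (auto simp: in_keys_iff lookup_minus)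

lemma degree_less_0 [simp]: "degree_less 0 = {0}"
  by (auto simp: degree_less_def in_keys_iff intro: poly_mapping_eqI)

lemma degree_less_Suc: "degree_less (Suc m) = degree_le m"
  by (auto simp: degree_less_def degree_le_def)

lemma zero_in_degree [simp]: "0 \<in> degree_less m" "0 \<in> degree_le m" "0 \<in> homogeneous m"
  by (simp_all add: degree_less_def degree_le_def homogeneous_def)

lemma degree_add_closed:
  "f \<in> degree_less m \<Longrightarrow> g \<in> degree_less m \<Longrightarrow> f + g \<in> degree_less m"
  "f \<in> degree_le m \<Longrightarrow> g \<in> degree_le m \<Longrightarrow> f + g \<in> degree_le m"
  "f \<in> homogeneous m \<Longrightarrow> g \<in> homogeneous m \<Longrightarrow> f + g \<in> homogeneous m"
  unfolding degree_less_def degree_le_def homogeneous_def using keys_add[of f g] by blast+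

lemma degree_diff_closed:
  "f \<in> degree_less m \<Longrightarrow> g \<in> degree_less m \<Longrightarrow> f - g \<in> degree_less m"
  "f \<in> degree_le m \<Longrightarrow> g \<in> degree_le m \<Longrightarrow> f - g \<in> degree_le m"
  unfolding degree_less_def degree_le_def using keys_diff_free[of f g] by blast+

lemma degree_minus_closed: "f \<in> degree_less m \<Longrightarrow> - f \<in> degree_less m"
  using degree_diff_closed(1)[of 0 m f] by simp

lemma degree_less_mono: "f \<in> degree_less m \<Longrightarrow> m \<le> n \<Longrightarrow> f \<in> degree_less n"
  by (force simp: degree_less_def)

lemma degree_mult:
  "f \<in> degree_le m \<Longrightarrow> g \<in> degree_le n \<Longrightarrow> f * g \<in> degree_le (m + n)"
  "f \<in> degree_le m \<Longrightarrow> g \<in> degree_less n \<Longrightarrow> f * g \<in> degree_less (m + n)"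
  "f \<in> degree_less m \<Longrightarrow> g \<in> degree_le n \<Longrightarrow> f * g \<in> degree_less (m + n)"
  "f \<in> homogeneous m \<Longrightarrow> g \<in> homogeneous n \<Longrightarrow> f * g \<in> homogeneous (m + n)"
proof -
  have *: "\<exists>u v. w = u + v \<and> u \<in> Poly_Mapping.keys f \<and> v \<in> Poly_Mapping.keys g"
    if "w \<in> Poly_Mapping.keys (f * g)" for w
    using keys_mult[of f g] that by blast
  show "f \<in> degree_le m \<Longrightarrow> g \<in> degree_le n \<Longrightarrow> f * g \<in> degree_le (m + n)"
    unfolding degree_le_def by (auto dest!: * intro!: add_mono)
  show "f \<in> degree_le m \<Longrightarrow> g \<in> degree_less n \<Longrightarrow> f * g \<in> degree_less (m + n)"
    unfolding degree_le_def degree_less_def by (auto dest!: * intro!: add_le_less_mono)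
  show "f \<in> degree_less m \<Longrightarrow> g \<in> degree_le n \<Longrightarrow> f * g \<in> degree_less (m + n)"
    unfolding degree_le_def degree_less_def by (auto dest!: * intro!: add_less_le_mono)
  show "f \<in> homogeneous m \<Longrightarrow> g \<in> homogeneous n \<Longrightarrow> f * g \<in> homogeneous (m + n)"
    unfolding homogeneous_def by (auto dest!: *)
qed

lemma single_degree:
  "length (letters w) \<le> m \<Longrightarrow> Poly_Mapping.single w r \<in> degree_le m"
  "length (letters w) < m \<Longrightarrow> Poly_Mapping.single w r \<in> degree_less m"
  "length (letters w) = m \<Longrightarrow> Poly_Mapping.single w r \<in> homogeneous m"
  by (simp_all add: degree_le_def degree_less_def homogeneous_def)

lemma const_degree: "const r \<in> homogeneous 0" "const r \<in> degree_le m"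
  by (simp_all add: const_def single_degree)

lemma gen_degree: "gen x \<in> homogeneous 1"
  by (simp add: gen_def single_degree)

lemma component_homogeneous [simp]: "component m f \<in> homogeneous m"
  by (auto simp: homogeneous_def keys_restrict_words)

lemma component_of_homogeneous: "f \<in> homogeneous m \<Longrightarrow> component n f = (if n = m then f else 0)"
proof (intro poly_mapping_eqI)
  fix w assume "f \<in> homogeneous m"
  then have "length (letters w) = m \<or> Poly_Mapping.lookup f w = 0"
    by (auto simp: homogeneous_def in_keys_iff)
  then show "Poly_Mapping.lookup (component n f) w = Poly_Mapping.lookup (if n = m then f else 0) w"
    by (auto simp: restrict_words.rep_eq)
qed

lemma degree_less_iff_component:
  assumes "f \<in> degree_less (Suc m)"
  shows "f - component m f \<in> degree_less m"
  unfolding degree_less_def mem_Collect_eq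
proof
  fix w assume w: "w \<in> Poly_Mapping.keys (f - component m f)"
  then have "length (letters w) \<noteq> m" "w \<in> Poly_Mapping.keys f"
    by (auto simp: in_keys_iff lookup_minus restrict_words.rep_eq split: if_splits)
  then show "length (letters w) < m" using assms by (auto simp: degree_less_def less_Suc_eq)
qed

lemma exists_degree_le: "\<exists>m. f \<in> degree_le m"
  by (rule exI[of _ "\<Sum>w\<in>Poly_Mapping.keys f. length (letters w)"])
     (auto simp: degree_le_def intro: member_le_sum)

lemma homogeneous_degree_le: "f \<in> homogeneous m \<Longrightarrow> f \<in> degree_le m"
  by (auto simp: homogeneous_def degree_le_def)

text \<open>The claim is proved for the component of degree \<open>m\<close> of an arbitrary
  \<open>g\<close>, by induction on \<open>g\<close>; a homogeneous element is its own
  component.\<close>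

lemma homogeneous_induct [consumes 1, case_names single add zero]:
  assumes "f \<in> homogeneous m"
    and single: "\<And>w r. length (letters w) = m \<Longrightarrow> P (Poly_Mapping.single w r)"
    and add: "\<And>f g. f \<in> homogeneous m \<Longrightarrow> g \<in> homogeneous m \<Longrightarrow> P f \<Longrightarrow> P g \<Longrightarrow> P (f + g)"
    and zero: "P 0"
  shows "P f"
proof -
  have "P (component m g)" for g
  proof (induction g rule: free_induct)
    case (single w r)
    then show ?case using assms(2) zero by (simp add: restrict_words_single)
  next
    case (add f g)
    then show ?case using assms(3) by (simp add: restrict_words_add)
  qed
  then show ?thesis using component_of_homogeneous[OF assms(1), of m] by metis
qed

subsection \<open>Two-sided ideals\<close>

text \<open>Negatives come from left multiplication by - 1. The inductive form gives rule induction;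
  \<open>genideal_eq_ideal_span\<close> identifies it with the ideal used in
  \<open>presented\<close>.\<close>

inductive_set ideal_span :: "'k::field free set \<Rightarrow> 'k free set" for S where
  zero: "0 \<in> ideal_span S"
| base: "f \<in> S \<Longrightarrow> f \<in> ideal_span S"
| add: "f \<in> ideal_span S \<Longrightarrow> g \<in> ideal_span S \<Longrightarrow> f + g \<in> ideal_span S"
| mult_left: "f \<in> ideal_span S \<Longrightarrow> g * f \<in> ideal_span S"
| mult_right: "f \<in> ideal_span S \<Longrightarrow> f * g \<in> ideal_span S"

locale free_ideal =
  fixes K :: "'k::field free set"
  assumes zero [simp]: "0 \<in> K"
    and add: "f \<in> K \<Longrightarrow> g \<in> K \<Longrightarrow> f + g \<in> K"
    and mult_left: "f \<in> K \<Longrightarrow> g * f \<in> K"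
    and mult_right: "f \<in> K \<Longrightarrow> f * g \<in> K"
begin

lemma minus: "f \<in> K \<Longrightarrow> - f \<in> K"
  using mult_left[of f "- 1"] by simp

lemma diff: "f \<in> K \<Longrightarrow> g \<in> K \<Longrightarrow> f - g \<in> K"
  using add[of f "- g"] minus by simp

lemma span_subset: "S \<subseteq> K \<Longrightarrow> ideal_span S \<subseteq> K"
proof
  fix f assume "S \<subseteq> K" "f \<in> ideal_span S"
  from this(2) show "f \<in> K"
    by induction (use \<open>S \<subseteq> K\<close> in \<open>auto intro: add mult_left mult_right\<close>)
qed

lemma const_cancel: "const r * f \<in> K \<Longrightarrow> r \<noteq> 0 \<Longrightarrow> f \<in> K"
  using mult_left[of "const r * f" "const (1 / r)"] by (simp flip: mult.assoc const_mult)

end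

lemma free_ideal_span: "free_ideal (ideal_span S)"
  by standard (auto intro: ideal_span.intros)

lemma ring_free: "ring (ring_of_type_algebra :: 'k::field free ring)"
proof -
  have "\<exists>y. x + y = 0" for x :: "'k free" using add.right_inverse by blast
  then show ?thesis
    unfolding ring_of_type_algebra_def using add.right_inverse
    by unfold_locales (auto simp: algebra_simps Units_def)
qed

lemma genideal_eq_ideal_span: "genideal (ring_of_type_algebra :: 'k::field free ring) S = ideal_span S"
proof -
  interpret R: ring "ring_of_type_algebra :: 'k free ring" by (rule ring_free)
  let ?R = "ring_of_type_algebra :: 'k free ring"
  have inv: "\<ominus>\<^bsub>?R\<^esub> f = - f" for f
    by (rule R.minus_equality) (simp_all add: ring_of_type_algebra_def)
  have carr: "carrier ?R = UNIV" by (simp add: ring_of_type_algebra_def)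
  interpret J: free_ideal "ideal_span S" by (rule free_ideal_span)
  have "ideal (ideal_span S) ?R"
  proof (rule idealI[OF ring_free])
    have "inv\<^bsub>add_monoid ?R\<^esub> f = - f" for f using inv by (simp add: a_inv_def)
    moreover have "ideal_span S \<noteq> {}" using ideal_span.zero by blast
    moreover have "f \<otimes>\<^bsub>add_monoid ?R\<^esub> g = f + g" for f g by (simp add: ring_of_type_algebra_def)
    ultimately show "subgroup (ideal_span S) (add_monoid ?R)"
      by (intro R.add.subgroupI) (simp_all add: inv carr J.minus J.add)
  qed (auto simp: ring_of_type_algebra_def intro: ideal_span.intros)
  then have "genideal ?R S \<subseteq> ideal_span S"
    by (rule R.genideal_minimal) (auto intro: ideal_span.base)
  moreover have "ideal_span S \<subseteq> genideal ?R S"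
  proof
    interpret I: ideal "genideal ?R S" ?R by (rule R.genideal_ideal) (simp add: carr)
    fix f assume "f \<in> ideal_span S"
    then show "f \<in> genideal ?R S"
    proof induction
      case zero
      show ?case using I.zero_closed by (simp add: ring_of_type_algebra_def)
    next
      case (base f)
      then show ?case using R.genideal_self[of S] by (auto simp: carr)
    next
      case (add f g)
      then show ?case using I.a_closed[of f g] by (simp add: ring_of_type_algebra_def)
    next
      case (mult_left f g)
      then show ?case using I.I_l_closed[of f g] by (simp add: ring_of_type_algebra_def)
    next
      case (mult_right f g)
      then show ?case using I.I_r_closed[of f g] by (simp add: ring_of_type_algebra_def)
    qed
  qed
  ultimately show ?thesis by blast
qed

section \<open>Consequences of the quadratic relations\<close>

definition letter_sum :: "'k::field free" where
  "letter_sum = gen La + gen Lb + gen Lc + gen Ld"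

text \<open>A symmetric form of $cb + ba + ac - \<beta>$ and its conjugates:
  \<open>letter_sum\<close> is fixed by all permutations of the letters, so relabelling only moves
  the index \<open>x\<close>. The agreement with the cubic base modulo the relations is
  \<open>Z_d_alt\<close>; the constant is the one for which the four elements add up to zero
  (\<open>Z_sum\<close>).\<close>

definition braid_elem :: "'k::field \<Rightarrow> 'k \<Rightarrow> letter \<Rightarrow> 'k free" where
  "braid_elem \<alpha> \<beta> x = const \<alpha> + const \<alpha> + const \<beta> + const \<beta> - (letter_sum * gen x + gen x * letter_sum)"

text \<open>The quadratic relations other than the squares have this shape, with $z$ equal to
  \<open>letter_perm x y\<close>.\<close>

definition triple :: "letter \<Rightarrow> letter \<Rightarrow> letter \<Rightarrow> 'k::field free" where
  "triple x y z = gen x * gen y + gen y * gen z + gen z * gen x"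

lemma gen_const: "gen x * const r = const r * gen x"
  and gen_const_mult: "gen x * (const r * f) = const r * (gen x * f)"
  by (rule const_commute const_left_commute)+

lemma relabel_letter_sum:
  assumes "bij \<pi>"
  shows "relabel \<pi> letter_sum = (letter_sum :: 'k::field free)"
proof -
  have U: "(UNIV :: letter set) = {La, Lb, Lc, Ld}" using letter.exhaust by auto
  then have *: "letter_sum = (\<Sum>x\<in>UNIV. gen x :: 'k free)" unfolding letter_sum_def U by (simp add: add.assoc)
  have "relabel \<pi> letter_sum = (\<Sum>x\<in>UNIV. gen (\<pi> x) :: 'k free)" unfolding * subst_sum subst_gen ..
  also have "\<dots> = (\<Sum>x\<in>UNIV. gen x)" by (rule sum.reindex_bij_betw[OF assms])
  finally show ?thesis using * by simp
qed

lemma relabel_braid_elem: "bij \<pi> \<Longrightarrow> relabel \<pi> (braid_elem \<alpha> \<beta> x) = braid_elem \<alpha> \<beta> (\<pi> x)"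
  by (simp add: braid_elem_def subst_diff subst_add subst_mult relabel_letter_sum)

text \<open>Each \<open>letter_perm x\<close> is a 3-cycle fixing \<open>x\<close>, and the
  operation is conjugation within this class of four 3-cycles. Self-distributivity is what allows
  identities indexed by letters to be moved by relabelling.\<close>

lemma letter_perm_distrib:
  "letter_perm x (letter_perm y z) = letter_perm (letter_perm x y) (letter_perm x z)"
  by (cases x; cases y; cases z) simp_all

lemma letter_perm_transitive: "\<exists>v. letter_perm v x = y \<or> x = y"
  by (cases x; cases y) (metis letter_perm.simps)+

text \<open>The group acts by signed permutations of the letters. Permutation and sign are kept
  apart since the permutations serve the averaging, while the sign separates even from odd
  degrees.\<close>

locale stable_ideal = free_ideal K for K :: "'k::field free set" +
  assumes relabel: "f \<in> K \<Longrightarrow> relabel (letter_perm y) f \<in> K"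
    and negate: "f \<in> K \<Longrightarrow> negate f \<in> K"

text \<open>One square and one triple are enough: relabelling yields the others with the same
  constants.\<close>

locale quadratic_ideal = stable_ideal K for K :: "'k::field free set" +
  fixes \<alpha> \<beta> :: 'k
  assumes square_a: "(gen La)\<^sup>2 - const \<alpha> \<in> K"
    and triple_abc: "triple La Lb Lc - const \<beta> \<in> K"
begin

abbreviation Z :: "letter \<Rightarrow> 'k free" where "Z \<equiv> braid_elem \<alpha> \<beta>"

lemma square: "gen x * gen x - const \<alpha> \<in> K"
proof -
  have a: "gen La * gen La - const \<alpha> \<in> K" using square_a by (simp add: power2_eq_square)
  obtain v where "letter_perm v La = x \<or> La = x" using letter_perm_transitive by blast
  then show ?thesis using relabel[OF a, of v] a by (auto simp: subst_diff subst_mult)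
qed

lemma triples:
  "triple La Lb Lc - const \<beta> \<in> K" "triple La Lc Ld - const \<beta> \<in> K"
  "triple La Ld Lb - const \<beta> \<in> K" "triple Lb Ld Lc - const \<beta> \<in> K"
proof -
  note * = relabel[of "triple _ _ _ - const \<beta>", unfolded triple_def subst_diff subst_add subst_mult subst_gen subst_const]
  show abc: "triple La Lb Lc - const \<beta> \<in> K" by (rule triple_abc)
  show acd: "triple La Lc Ld - const \<beta> \<in> K"
    using *[of La Lb Lc La] abc by (simp add: triple_def algebra_simps)
  show "triple La Ld Lb - const \<beta> \<in> K"
    using *[of La Lc Ld La] acd by (simp add: triple_def algebra_simps)
  show "triple Lb Ld Lc - const \<beta> \<in> K"
    using *[of La Lb Lc Lc] abc by (simp add: triple_def algebra_simps)
qed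

lemma Z_relabel: "relabel (letter_perm v) (Z x) = Z (letter_perm v x)"
  by (rule relabel_braid_elem[OF bij_letter_perm])

text \<open>The three triples through $d$ add up to all mixed products of $d$ with $a$, $b$, $c$,
  plus $cb + ba + ac$.\<close>

lemma Z_d_alt:
  "Z Ld - (gen Lc * gen Lb + gen Lb * gen La + gen La * gen Lc - const \<beta>) \<in> K"
proof -
  have "Z Ld - (gen Lc * gen Lb + gen Lb * gen La + gen La * gen Lc - const \<beta>) =
    - (triple La Lc Ld - const \<beta>) - (triple La Ld Lb - const \<beta>) - (triple Lb Ld Lc - const \<beta>)
    - (gen Ld * gen Ld - const \<alpha>) - (gen Ld * gen Ld - const \<alpha>)"
    by (simp add: braid_elem_def triple_def letter_sum_def const_add algebra_simps)
  also have "\<dots> \<in> K" by (simp only: diff minus triples square)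
  finally show ?thesis .
qed

lemma Z_gen_base: "Z Ld * gen La - gen Lc * Z Ld \<in> K"
proof -
  let ?a = "gen La :: 'k free" and ?b = "gen Lb :: 'k free" and ?c = "gen Lc :: 'k free"
  let ?W = "?c * ?b + ?b * ?a + ?a * ?c - const \<beta>"
  let ?R = "triple La Lb Lc - const \<beta>"
  \<comment> \<open>Expanding $Wa - cW$ leaves $aca - cac$, a multiple of $c - a$ and terms with a
    square. In \<open>?a * ?R - ?R * ?c\<close> the words $abc$ cancel, which produces the same
    difference up to squares.\<close>
  have "Z Ld * ?a - ?c * Z Ld = (Z Ld - ?W) * ?a - ?c * (Z Ld - ?W)
      + ?b * (?a * ?a - const \<alpha>) - (?c * ?c - const \<alpha>) * ?b + ?a * ?R - ?R * ?c
      - (?a * ?a - const \<alpha>) * ?b + ?b * (?c * ?c - const \<alpha>)"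
    by (simp add: triple_def algebra_simps gen_const gen_const_mult)
  also have "\<dots> \<in> K"
    by (simp only: diff add mult_left mult_right Z_d_alt triples square)
  finally show ?thesis .
qed

text \<open>The terms $xSx$ cancel, where $S$ is \<open>letter_sum\<close>; only $x^2 S$ and $S x^2$
  survive, and $x^2$ is the scalar \<alpha> modulo \<open>K\<close>.\<close>

lemma Z_gen_same: "Z x * gen x - gen x * Z x \<in> K"
proof -
  have "Z x * gen x - gen x * Z x =
      (gen x * gen x - const \<alpha>) * letter_sum - letter_sum * (gen x * gen x - const \<alpha>)"
    by (simp add: braid_elem_def algebra_simps gen_const gen_const_mult const_commute[of letter_sum])
  also have "\<dots> \<in> K" by (simp only: diff mult_left mult_right square)
  finally show ?thesis .
qed

lemma Z_gen_transport:
  "Z y * gen x - gen (letter_perm y x) * Z y \<in> K \<Longrightarrow>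
   Z (letter_perm v y) * gen (letter_perm v x) - gen (letter_perm (letter_perm v y) (letter_perm v x)) * Z (letter_perm v y) \<in> K"
  using relabel[of "Z y * gen x - gen (letter_perm y x) * Z y" v]
  by (simp add: subst_diff subst_mult Z_relabel letter_perm_distrib[of v y x])

text \<open>Relabelling by \<open>Ld\<close> fixes \<open>Z Ld\<close> and turns the base case for
  $a$ into those for $c$ and $b$; $d$ is \<open>Z_gen_same\<close>. Transitivity on the letters then
  moves \<open>Ld\<close> to any \<open>y\<close>.\<close>

lemma Z_gen: "Z y * gen x - gen (letter_perm y x) * Z y \<in> K"
proof -
  have a: "Z Ld * gen La - gen (letter_perm Ld La) * Z Ld \<in> K" using Z_gen_base by simp
  note c = Z_gen_transport[OF a, of Ld, simplified]
  have b: "Z Ld * gen Lb - gen (letter_perm Ld Lb) * Z Ld \<in> K"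
    using Z_gen_transport[of Ld Lc Ld] c by simp
  have d: "Z Ld * gen x - gen (letter_perm Ld x) * Z Ld \<in> K" for x
    using a b c Z_gen_same[of Ld] by (cases x) simp_all
  obtain v where v: "letter_perm v Ld = y \<or> Ld = y" using letter_perm_transitive by blast
  obtain x' where x': "x = letter_perm v x'" using bij_letter_perm[of v] by (metis bij_pointE)
  show ?thesis using v d[of x] Z_gen_transport[OF d[of x'], of v] x' by auto
qed

text \<open>Moving \<open>Z y\<close> past the letters only permutes them, so it commutes with their
  sum.\<close>

lemma Z_letter_sum: "Z y * letter_sum - letter_sum * Z y \<in> K"
proof -
  have "Z y * letter_sum - letter_sum * Z y =
    (Z y * gen La - gen (letter_perm y La) * Z y) + (Z y * gen Lb - gen (letter_perm y Lb) * Z y)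
    + (Z y * gen Lc - gen (letter_perm y Lc) * Z y) + (Z y * gen Ld - gen (letter_perm y Ld) * Z y)"
    unfolding letter_sum_def by (cases y) (simp_all add: algebra_simps)
  also have "\<dots> \<in> K" by (simp only: add Z_gen)
  finally show ?thesis .
qed

text \<open>\<open>Z y\<close> is built from constants, \<open>letter_sum\<close> and the letter
  \<open>y\<close>. The first two commute with \<open>Z x\<close> modulo \<open>K\<close>, so the
  rule \<open>Z_gen\<close> for letters passes to \<open>Z y\<close>.\<close>

lemma Z_Z: "Z x * Z y - Z (letter_perm x y) * Z x \<in> K"
proof -
  let ?S = "letter_sum :: 'k free" and ?y = "gen (letter_perm x y) :: 'k free"
  have "Z x * Z y - Z (letter_perm x y) * Z x =
    - ((Z x * ?S - ?S * Z x) * gen y) - ?S * (Z x * gen y - ?y * Z x)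
    - (Z x * gen y - ?y * Z x) * ?S - ?y * (Z x * ?S - ?S * Z x)"
    unfolding braid_elem_def[of _ _ y] braid_elem_def[of _ _ "letter_perm x y"]
    by (simp add: algebra_simps const_commute[of "Z x"])
  also have "\<dots> \<in> K" by (simp only: add diff minus mult_left mult_right Z_gen Z_letter_sum)
  finally show ?thesis .
qed

text \<open>The sixteen products in the square of \<open>letter_sum\<close> are the four squares and
  the terms of the four triples, each once. Hence that square is $4 \<alpha> + 4 \<beta>$ modulo
  \<open>K\<close>, which cancels the constants.\<close>

lemma Z_sum: "Z La + Z Lb + Z Lc + Z Ld \<in> K"
proof -
  let ?R = "(triple La Lb Lc - const \<beta>) + (triple La Lc Ld - const \<beta>) + (triple La Ld Lb - const \<beta>)
    + (triple Lb Ld Lc - const \<beta>) + (gen La * gen La - const \<alpha>) + (gen Lb * gen Lb - const \<alpha>)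
    + (gen Lc * gen Lc - const \<alpha>) + (gen Ld * gen Ld - const \<alpha>)"
  have "Z La + Z Lb + Z Lc + Z Ld = - ?R - ?R"
    by (simp add: braid_elem_def triple_def letter_sum_def const_add algebra_simps)
  also have "\<dots> \<in> K" by (simp only: diff minus add triples square)
  finally show ?thesis .
qed

text \<open>
  Modulo \<open>K\<close> the \<open>Z x\<close> satisfy the relations \<open>Z x * Z y = Z (letter_perm x y) * Z x\<close> of the group $G$
  and add up to zero; the certificate below was found by linear algebra in degree 3.
\<close>

lemma Z_cube_d_a: "Z Ld ^ 3 - Z La ^ 3 \<in> K"
proof -
  define B where "B x y = Z x * Z y - Z (letter_perm x y) * Z x" for x y
  define S where "S = Z La + Z Lb + Z Lc + Z Ld"
  have B: "B x y \<in> K" for x y by (simp add: B_def Z_Z)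
  have S: "S \<in> K" by (simp add: S_def Z_sum)
  have "Z Ld ^ 3 - Z La ^ 3 = - (Z Lc * B Lc La) + B Ld Lb * Z Ld + S * Z Lc * Z La + B Ld La * Z Ld
    - Z Ld * Z Lc * S - Z Ld * B La Ld - Z Ld * B Lb Ld + B Ld Lc * Z Ld - B Lc Lb * Z Lc
    - Z La * S * Z La + S * Z Ld * Z Ld + B Lc La * Z La + B La Lb * Z La - B Ld Lb * Z La"
    by (simp add: B_def S_def algebra_simps power3_eq_cube)
  also have "\<dots> \<in> K" by (simp only: diff minus add mult_left mult_right B S)
  finally show ?thesis .
qed

text \<open>Relabelling by \<open>Ld\<close> fixes \<open>Z Ld\<close> and cycles $a$, $c$, $b$, so
  the case of $a$ yields the others.\<close>

lemma Z_cube: "Z x ^ 3 - Z Ld ^ 3 \<in> K"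
proof -
  have step: "Z Ld ^ 3 - Z (letter_perm Ld x) ^ 3 \<in> K" if "Z Ld ^ 3 - Z x ^ 3 \<in> K" for x
    using relabel[OF that, of Ld] by (simp add: subst_diff subst_power Z_relabel)
  have "Z Ld ^ 3 - Z x ^ 3 \<in> K"
    using Z_cube_d_a step[OF Z_cube_d_a] step[OF step[OF Z_cube_d_a]] by (cases x) simp_all
  from minus[OF this] show ?thesis by simp
qed

lemma Z_cube_commute_d: "Z Ld ^ 3 * gen Ld - gen Ld * Z Ld ^ 3 \<in> K"
proof -
  let ?k = "Z Ld * gen Ld - gen Ld * Z Ld"
  have "Z Ld ^ 3 * gen Ld - gen Ld * Z Ld ^ 3 = Z Ld * Z Ld * ?k + Z Ld * ?k * Z Ld + ?k * Z Ld * Z Ld"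
    by (simp add: algebra_simps power3_eq_cube)
  also have "\<dots> \<in> K" by (simp only: add mult_left mult_right Z_gen_same)
  finally show ?thesis .
qed

end

section \<open>Averaging over the alternating group\<close>

definition quad :: "letter \<Rightarrow> letter \<Rightarrow> letter \<Rightarrow> letter \<Rightarrow> letter \<Rightarrow> letter" where
  "quad p q r s x = (case x of La \<Rightarrow> p | Lb \<Rightarrow> q | Lc \<Rightarrow> r | Ld \<Rightarrow> s)"

lemma quad_simps [simp]:
  "quad p q r s La = p" "quad p q r s Lb = q" "quad p q r s Lc = r" "quad p q r s Ld = s"
  by (simp_all add: quad_def)

lemma quad_letter_perm:
  "quad p q r s (letter_perm La x) = quad p r s q x"
  "quad p q r s (letter_perm Lb x) = quad s q p r x"
  "quad p q r s (letter_perm Lc x) = quad q s r p x"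
  "quad p q r s (letter_perm Ld x) = quad r p q s x"
  by (cases x; simp)+

lemma letter_perm_quad:
  "letter_perm y (quad p q r s x) = quad (letter_perm y p) (letter_perm y q) (letter_perm y r) (letter_perm y s) x"
  by (cases x) simp_all

lemma quad_id: "quad La Lb Lc Ld x = x"
  by (cases x) simp_all

lemma bij_quad:
  assumes "distinct [p, q, r, s]"
  shows "bij (quad p q r s)"
proof -
  have "finite (UNIV :: letter set)"
    by (rule finite_subset[of _ "{La, Lb, Lc, Ld}"]) (use letter.exhaust in auto)
  moreover have "inj (quad p q r s)"
  proof
    fix x y assume "quad p q r s x = quad p q r s y"
    then show "x = y" using assms by (cases x; cases y) auto
  qed
  ultimately show ?thesis by (simp add: bij_def finite_UNIV_inj_surj)
qed

text \<open>The sum over the twelve even permutations of the letters, given by the images of $a, b,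
  c, d$. It is not normalised; the factor 12 is removed only in \<open>eq_T_ideal\<close>.\<close>

definition average :: "'k::field free \<Rightarrow> 'k free" where
  "average f =
    relabel (quad La Lb Lc Ld) f +
    relabel (quad La Lc Ld Lb) f +
    relabel (quad Ld Lb La Lc) f +
    relabel (quad Lb Ld Lc La) f +
    relabel (quad Lc La Lb Ld) f +
    relabel (quad La Ld Lb Lc) f +
    relabel (quad Ld La Lc Lb) f +
    relabel (quad Lb Lc La Ld) f +
    relabel (quad Lc Lb Ld La) f +
    relabel (quad Lb La Ld Lc) f +
    relabel (quad Lc Ld La Lb) f +
    relabel (quad Ld Lc Lb La) f"

lemma average_add: "average (f + g) = average f + average g"
  and average_diff: "average (f - g) = average f - average g"
  and average_const_mult: "average (const r * f) = const r * average f"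
  by (simp_all only: average_def subst_add subst_diff subst_mult subst_const distrib_left add_diff_add add_ac)

text \<open>Composition with \<open>letter_perm y\<close> on the right permutes the twelve
  summands.\<close>

lemma average_relabel: "average (relabel (letter_perm y) f) = average f"
  unfolding average_def relabel_relabel o_def
  by (cases y) (simp_all add: quad_letter_perm add_ac)

lemma average_const: "average (const r) = const (12 * r)"
proof -
  have "average (const r) = const (r + r + r + r + r + r + r + r + r + r + r + r)"
    by (simp only: average_def subst_const const_add add_ac)
  then show ?thesis by simp
qed

lemmas average_eval = average_def subst_add subst_diff relabel_wd list.map quad_simps

abbreviation even_part :: "'k::field free \<Rightarrow> 'k free" where
  "even_part \<equiv> restrict_words (\<lambda>w. even (length (letters w)))"

text \<open>This is the average over the sign: words of odd length cancel.\<close>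

lemma add_negate: "f + negate f = const 2 * even_part f"
proof (induction f rule: free_induct)
  case (single w r)
  have "negate (Poly_Mapping.single w r) = (- 1) ^ length (letters w) * Poly_Mapping.single w r"
    using negate_wd[of "letters w"] arg_cong[OF negate_wd[of "letters w"], of "\<lambda>f. const r * f"]
    by (simp add: subst_single const_mult_single minus_one_power_iff split: if_splits)
  then show ?case
    by (cases "even (length (letters w))") (simp_all add: restrict_words_single mult_2)
next
  case (add f g)
  have "f + g + negate (f + g) = (f + negate f) + (g + negate g)" by (simp add: subst_add add_ac)
  then show ?case using add by (simp add: restrict_words_add distrib_left)
qed

context stable_ideal
begin

lemma relabel_quad:
  assumes "relabel (quad p q r s) f \<in> K"
  shows "relabel (quad (letter_perm y p) (letter_perm y q) (letter_perm y r) (letter_perm y s)) f \<in> K"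
  using relabel[OF assms, of y] by (simp only: relabel_relabel o_def letter_perm_quad)

lemma average_closed:
  assumes "f \<in> K"
  shows "average f \<in> K"
proof -
  \<comment> \<open>The even permutations are reached from the identity by composing 3-cycles on the
    left: four after one step, four more after a second, and the three double transpositions after a
    third.\<close>
  have abcd: "relabel (quad La Lb Lc Ld) f \<in> K" using assms by (simp add: quad_id subst_gen_id)
  note acdb = relabel_quad[OF abcd, of La, simplified]
    and dbac = relabel_quad[OF abcd, of Lb, simplified]
    and bdca = relabel_quad[OF abcd, of Lc, simplified]
    and cabd = relabel_quad[OF abcd, of Ld, simplified]
  note adbc = relabel_quad[OF acdb, of La, simplified]
    and dacb = relabel_quad[OF acdb, of Lb, simplified]
    and bcad = relabel_quad[OF acdb, of Lc, simplified]
    and cbda = relabel_quad[OF acdb, of Ld, simplified]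
  note badc = relabel_quad[OF dacb, of La, simplified]
    and cdab = relabel_quad[OF bcad, of La, simplified]
    and dcba = relabel_quad[OF cbda, of La, simplified]
  show ?thesis unfolding average_def
    by (intro add abcd acdb dbac bdca cabd adbc dacb bcad cbda badc cdab dcba)
qed

end

context quadratic_ideal
begin

text \<open>
  Up to scalars and \<open>K\<close>, the averages of the elements of \<open>L\<close> are multiples of a single one.
\<close>

definition L :: "'k free set" where
  "L = {f. \<exists>c s. average f - const c * average (wd [La, Lb, La, Lc]) - const s \<in> K}"

lemma LI: "average f - const c * average (wd [La, Lb, La, Lc]) - const s \<in> K \<Longrightarrow> f \<in> L"
  by (auto simp: L_def)

lemma L_cong: "f \<in> L \<Longrightarrow> average f = average g \<Longrightarrow> g \<in> L"
  by (simp add: L_def)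

lemma L_diff:
  assumes "f \<in> L" "g \<in> L"
  shows "f - g \<in> L"
proof -
  let ?w = "average (wd [La, Lb, La, Lc]) :: 'k free"
  obtain c s c' s' where "average f - const c * ?w - const s \<in> K" "average g - const c' * ?w - const s' \<in> K"
    using assms by (auto simp: L_def)
  from diff[OF this] show ?thesis
    by (intro LI[of _ "c - c'" "s - s'"]) (simp add: average_diff const_diff algebra_simps)
qed

lemma L_const_mult:
  assumes "f \<in> L"
  shows "const r * f \<in> L"
proof -
  let ?w = "average (wd [La, Lb, La, Lc]) :: 'k free"
  obtain c s where "average f - const c * ?w - const s \<in> K"
    using assms by (auto simp: L_def)
  from mult_left[OF this, of "const r"] show ?thesis
    by (intro LI[of _ "r * c" "r * s"]) (simp add: average_const_mult const_mult right_diff_distrib mult.assoc)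
qed

lemma K_L: "f \<in> K \<Longrightarrow> f \<in> L"
  by (rule LI[of _ 0 0]) (simp add: average_closed)

lemma L_add: "f \<in> L \<Longrightarrow> g \<in> L \<Longrightarrow> f + g \<in> L"
  using L_diff[of f "const (- 1) * g"] L_const_mult[of g "- 1"] by (simp add: const_minus)

lemma const_L: "const r \<in> L"
  by (rule LI[of _ 0 "12 * r"]) (simp add: average_const)

lemma abac: "wd [La, Lb, La, Lc] \<in> L"
  by (rule LI[of _ 1 0]) simp

lemma drop_square:
  assumes "wd (u @ v) \<in> L"
  shows "wd (u @ x # x # v) \<in> L"
proof -
  have "wd u * (gen x * gen x - const \<alpha>) * wd v \<in> K" by (intro mult_left mult_right square)
  then have "wd (u @ x # x # v) - const \<alpha> * wd (u @ v) \<in> K"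
    by (simp add: algebra_simps gen_eq_wd mult_single single_mult_const const_mult_single)
  from L_add[OF K_L[OF this] L_const_mult[OF assms, of \<alpha>]] show ?thesis by simp
qed

text \<open>A triple is unchanged by cyclic rotation, and the rotations of the four known triples
  exhaust the twelve ordered pairs of distinct letters.\<close>

lemma triple_letter_perm:
  assumes "x \<noteq> y"
  shows "triple x y (letter_perm x y) - const \<beta> \<in> K"
proof -
  have "triple y z x = (triple x y z :: 'k free)" for x y z by (simp add: triple_def add_ac)
  then show ?thesis using triples assms by (cases x; cases y) (simp_all, metis+)
qed

lemma triple_words:
  assumes "x \<noteq> y" "wd (u @ v) \<in> L"
  shows "wd (u @ x # y # v) + wd (u @ y # letter_perm x y # v) + wd (u @ letter_perm x y # x # v) \<in> L"
proof -
  have "wd u * (triple x y (letter_perm x y) - const \<beta>) * wd v \<in> K"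
    by (intro mult_left mult_right triple_letter_perm assms)
  then have "wd (u @ x # y # v) + wd (u @ y # letter_perm x y # v) + wd (u @ letter_perm x y # x # v)
    - const \<beta> * wd (u @ v) \<in> K"
    by (simp add: triple_def algebra_simps gen_eq_wd mult_single single_mult_const const_mult_single)
  from L_add[OF K_L[OF this] L_const_mult[OF assms(2), of \<beta>]] show ?thesis by simp
qed

lemma L_map: "wd (map (letter_perm v) l) \<in> L \<Longrightarrow> wd l \<in> L"
  by (erule L_cong) (metis average_relabel relabel_wd)

text \<open>The 3-cycles generate a doubly transitive group, and membership in \<open>L\<close>
  depends only on the average; so any word starting with two distinct letters may be relabelled to
  start with $ab$.\<close>

lemma L_transitive:
  assumes base: "\<And>zs. length zs = n \<Longrightarrow> wd (La # Lb # zs) \<in> L" and "x \<noteq> y" "length zs = n"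
  shows "wd (x # y # zs) \<in> L"
proof -
  have d: "wd (La # Ld # zs) \<in> L" if "length zs = n" for zs
    by (rule L_map[of La]) (use that base in simp)
  have c: "wd (La # Lc # zs) \<in> L" if "length zs = n" for zs
    by (rule L_map[of La]) (use that d in simp)
  have a: "wd (La # y # zs) \<in> L" if "length zs = n" "y \<noteq> La" for y zs
    using that base c d by (cases y) simp_all
  show ?thesis
  proof (cases x)
    case La
    then show ?thesis using assms a by simp
  next
    case Lb
    show ?thesis by (rule L_map[of Ld]) (use Lb assms(2,3) in \<open>cases y; simp add: a\<close>)
  next
    case Lc
    show ?thesis by (rule L_map[of Lb]) (use Lc assms(2,3) in \<open>cases y; simp add: a\<close>)
  next
    case Ld
    show ?thesis by (rule L_map[of Lc]) (use Ld assms(2,3) in \<open>cases y; simp add: a\<close>)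
  qed
qed

end

section \<open>Averages of words of even length at most 4\<close>

locale quadratic_ideal_char = quadratic_ideal +
  assumes two: "(2 :: 'a) \<noteq> 0" and three: "(3 :: 'a) \<noteq> 0"
begin

text \<open>The three terms of a triple have the same average, so a triple relation determines three
  times this average; here 3 is inverted.\<close>

lemma length_2_words: "wd [x, y] \<in> L"
proof (cases "x = y")
  case True
  then show ?thesis using drop_square[of "[]" "[]" x] const_L[of 1] by (simp add: wd_Nil)
next
  case False
  have "wd [La, Lb] + wd [Lb, Lc] + wd [Lc, La] \<in> L"
    using triple_words[of La Lb "[]" "[]"] const_L[of 1] by (simp add: wd_Nil)
  from L_const_mult[OF this, of "1 / 3"] have "wd [La, Lb] \<in> L"
  proof (rule L_cong)
    have "average (wd [La, Lb] + wd [Lb, Lc] + wd [Lc, La]) = const 3 * average (wd [La, Lb] :: 'a free)"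
    proof -
      have "average (wd [Lb, Lc]) = average (wd [La, Lb] :: 'a free)"
        "average (wd [Lc, La]) = average (wd [La, Lb] :: 'a free)"
        by (simp_all only: average_eval add_ac)
      moreover have "const 3 * f = f + f + f" for f :: "'a free"
      proof -
        have "const 3 = (1 + 1 + 1 :: 'a free)" by simp
        then show ?thesis by (simp only: distrib_right mult_1)
      qed
      ultimately show ?thesis by (simp only: average_add)
    qed
    then show "average (const (1 / 3) * (wd [La, Lb] + wd [Lb, Lc] + wd [Lc, La])) = average (wd [La, Lb] :: 'a free)"
      using three by (simp only: average_const_mult flip: mult.assoc const_mult) simp
  qed
  then show ?thesis using False L_transitive[of 0 x y "[]"] by simp
qed

lemma square_words: "wd [x, x, y, z] \<in> L" "wd [y, x, x, z] \<in> L" "wd [y, z, x, x] \<in> L"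
  using drop_square[of "[]" "[y, z]" x] drop_square[of "[y]" "[z]" x] drop_square[of "[y, z]" "[]" x] length_2_words
  by simp_all

lemma length_4_words: "wd [x, y, z, t] \<in> L"
proof -
  \<comment> \<open>By \<open>L_transitive\<close> and \<open>square_words\<close> only words $abzt$
    without a repeated neighbour remain. Each step below inserts one triple relation into a word of
    length 2, chosen such that two of its three words contain a square or have been settled up to
    relabelling; the third is the new word up to relabelling.\<close>
  have abca: "wd [La, Lb, Lc, La] \<in> L"
  proof (rule L_cong)
    show "wd [La, La, Lb, La] + wd [La, Lb, Lc, La] + wd [La, Lc, La, La] - wd [La, La, Lb, La] - wd [La, Lc, La, La] \<in> L"
      by (intro L_diff square_words abac triple_words[of La Lb "[La]" "[La]", simplified, OF length_2_words])
  qed (simp only: average_eval algebra_simps)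
  have abab: "wd [La, Lb, La, Lb] \<in> L"
  proof (rule L_cong)
    show "wd [La, Lb, La, Lb] + wd [Lb, Lc, La, Lb] + wd [Lc, La, La, Lb] - wd [La, Lb, Lc, La] - wd [Lc, La, La, Lb] \<in> L"
      by (intro L_diff square_words abac abca triple_words[of La Lb "[]" "[La, Lb]", simplified, OF length_2_words])
  qed (simp only: average_eval algebra_simps)
  have abcb: "wd [La, Lb, Lc, Lb] \<in> L"
  proof (rule L_cong)
    show "wd [La, Ld, La, Lb] + wd [Ld, Lb, La, Lb] + wd [Lb, La, La, Lb] - wd [La, Lb, La, Lc] - wd [Lb, La, La, Lb] \<in> L"
      by (intro L_diff square_words abac abca abab triple_words[of La Ld "[]" "[La, Lb]", simplified, OF length_2_words])
  qed (simp only: average_eval algebra_simps)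
  have abad: "wd [La, Lb, La, Ld] \<in> L"
  proof (rule L_cong)
    show "wd [La, La, Lb, Lb] + wd [La, Lb, Lc, Lb] + wd [La, Lc, La, Lb] - wd [La, La, Lb, Lb] - wd [La, Lb, Lc, Lb] \<in> L"
      by (intro L_diff square_words abac abca abab abcb triple_words[of La Lb "[La]" "[Lb]", simplified, OF length_2_words])
  qed (simp only: average_eval algebra_simps)
  have abcd: "wd [La, Lb, Lc, Ld] \<in> L"
  proof (rule L_cong)
    show "wd [La, La, Lc, Lb] + wd [La, Lc, Ld, Lb] + wd [La, Ld, La, Lb] - wd [La, La, Lc, Lb] - wd [La, Lb, La, Lc] \<in> L"
      by (intro L_diff square_words abac abca abab abcb abad triple_words[of La Lc "[La]" "[Lb]", simplified, OF length_2_words])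
  qed (simp only: average_eval algebra_simps)
  have abda: "wd [La, Lb, Ld, La] \<in> L"
  proof (rule L_cong)
    show "wd [La, Lb, La, Lc] + wd [La, Lb, Lc, Ld] + wd [La, Lb, Ld, La] - wd [La, Lb, La, Lc] - wd [La, Lb, Lc, Ld] \<in> L"
      by (intro L_diff square_words abac abca abab abcb abad abcd triple_words[of La Lc "[La, Lb]" "[]", simplified, OF length_2_words])
  qed (simp only: average_eval algebra_simps)
  have abdb: "wd [La, Lb, Ld, Lb] \<in> L"
  proof (rule L_cong)
    show "wd [La, Lb, La, Ld] + wd [La, Lb, Ld, Lb] + wd [La, Lb, Lb, La] - wd [La, Lb, La, Ld] - wd [La, Lb, Lb, La] \<in> L"
      by (intro L_diff square_words abac abca abab abcb abad abcd abda triple_words[of La Ld "[La, Lb]" "[]", simplified, OF length_2_words])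
  qed (simp only: average_eval algebra_simps)
  have abdc: "wd [La, Lb, Ld, Lc] \<in> L"
  proof (rule L_cong)
    show "wd [La, Lb, Lb, Ld] + wd [La, Lb, Ld, Lc] + wd [La, Lb, Lc, Lb] - wd [La, Lb, Lb, Ld] - wd [La, Lb, Lc, Lb] \<in> L"
      by (intro L_diff square_words abac abca abab abcb abad abcd abda abdb triple_words[of Lb Ld "[La, Lb]" "[]", simplified, OF length_2_words])
  qed (simp only: average_eval algebra_simps)
  have base: "wd [La, Lb, z, t] \<in> L" for z t
    by (cases z; cases t; simp add: abac abca abab abcb abad abcd abda abdb abdc square_words)
  show ?thesis
  proof (cases "x = y")
    case False
    have "wd (La # Lb # zs) \<in> L" if "length zs = 2" for zs
      using that base by (auto simp: length_Suc_conv numeral_2_eq_2)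
    from L_transitive[OF this False, where zs = "[z, t]"] show ?thesis by simp
  qed (simp add: square_words)
qed

lemma even_words: "even (length l) \<Longrightarrow> length l \<le> 5 \<Longrightarrow> wd l \<in> L"
proof -
  assume l: "even (length l)" "length l \<le> 5"
  have "length l = 0 \<or> length l = 2 \<or> length l = 4" using l by presburger
  then show ?thesis
    using const_L[of 1] length_2_words length_4_words
    by (auto simp: length_Suc_conv numeral_eq_Suc wd_Nil)
qed

lemma even_part_L:
  assumes "f \<in> degree_le 5"
  shows "even_part f \<in> L"
proof -
  have "restrict_words (\<lambda>w. even (length (letters w)) \<and> length (letters w) \<le> 5) g \<in> L" for g :: "'a free"
  proof (induction g rule: free_induct)
    case (single w r)
    then show ?case using even_words[of "letters w"] const_L[of 0] L_const_mult[of "wd (letters w)" r]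
      by (auto simp: restrict_words_single const_mult_single)
  qed (simp add: restrict_words_add L_add)
  moreover have "restrict_words (\<lambda>w. even (length (letters w)) \<and> length (letters w) \<le> 5) f = even_part f"
    using assms by (intro poly_mapping_eqI) (auto simp: restrict_words.rep_eq degree_le_def in_keys_iff)
  ultimately show ?thesis by metis
qed

section \<open>The invariant cube $Z_d^3$ and its average\<close>

lemma Z_cube_relabel_quad:
  assumes "distinct [p, q, r, s]"
  shows "relabel (quad p q r s) (Z Ld ^ 3) - Z Ld ^ 3 \<in> K"
  using Z_cube[of s] by (simp add: subst_power relabel_braid_elem[OF bij_quad[OF assms]])

lemma negate_Z: "negate (Z x) = Z x"
  by (simp add: braid_elem_def letter_sum_def subst_diff subst_add subst_mult algebra_simps)

lemma average_Z_cube: "average (Z Ld ^ 3) - const 12 * Z Ld ^ 3 \<in> K"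
proof -
  let ?z = "Z Ld ^ 3"
  have *: "const 12 * f = f + f + f + f + f + f + f + f + f + f + f + f" for f :: "'a free"
  proof -
    have "const 12 = (1 + 1 + 1 + 1 + 1 + 1 + 1 + 1 + 1 + 1 + 1 + 1 :: 'a free)" by simp
    then show ?thesis by (simp only: distrib_right mult_1)
  qed
  have "average ?z - const 12 * ?z =
    (relabel (quad La Lb Lc Ld) ?z - ?z) +
    (relabel (quad La Lc Ld Lb) ?z - ?z) +
    (relabel (quad Ld Lb La Lc) ?z - ?z) +
    (relabel (quad Lb Ld Lc La) ?z - ?z) +
    (relabel (quad Lc La Lb Ld) ?z - ?z) +
    (relabel (quad La Ld Lb Lc) ?z - ?z) +
    (relabel (quad Ld La Lc Lb) ?z - ?z) +
    (relabel (quad Lb Lc La Ld) ?z - ?z) +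
    (relabel (quad Lc Lb Ld La) ?z - ?z) +
    (relabel (quad Lb La Ld Lc) ?z - ?z) +
    (relabel (quad Lc Ld La Lb) ?z - ?z) +
    (relabel (quad Ld Lc Lb La) ?z - ?z)"
    unfolding * average_def by (simp only: algebra_simps)
  also have "\<dots> \<in> K" by (intro add Z_cube_relabel_quad) simp_all
  finally show ?thesis .
qed

text \<open>$Z_d^3$ is fixed by the sign and, modulo \<open>K\<close>, by the twelve permutations.
  Hence \<open>h\<close> may be replaced by its even part and then, at the cost of a factor 12, by
  the average of that part.\<close>

lemma Z_cube_average:
  assumes "Z Ld ^ 3 - h \<in> K" "h \<in> degree_le 5"
  obtains c s where "const 12 * Z Ld ^ 3 - const c * average (wd [La, Lb, La, Lc]) - const s \<in> K"
proof -
  let ?z = "Z Ld ^ 3" and ?w = "average (wd [La, Lb, La, Lc]) :: 'a free"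
  have "?z - negate h \<in> K" using negate[OF assms(1)] by (simp add: subst_diff subst_power negate_Z)
  from add[OF this assms(1)] have "const 2 * ?z - (h + negate h) \<in> K"
    by (simp add: mult_2 algebra_simps)
  then have "const 2 * (?z - even_part h) \<in> K" by (simp add: add_negate right_diff_distrib)
  then have e: "?z - even_part h \<in> K" by (rule const_cancel[OF _ two])
  obtain c s where "average (even_part h) - const c * ?w - const s \<in> K"
    using even_part_L[OF assms(2)] by (auto simp: L_def)
  from add[OF this diff[OF average_closed[OF e] average_Z_cube]]
  have "const 12 * ?z - const c * ?w - const s \<in> K" by (simp add: average_diff algebra_simps)
  then show thesis by (rule that)
qed

text \<open>Constants are central and $Z_d^3$ commutes with $d$ modulo \<open>K\<close>, so the
  remaining term of the relation must commute with $d$ too.\<close>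

lemma average_commutator:
  assumes "const 12 * Z Ld ^ 3 - const c * average (wd [La, Lb, La, Lc]) - const s \<in> K"
  shows "const c * (average (wd [La, Lb, La, Lc]) * gen Ld - gen Ld * average (wd [La, Lb, La, Lc])) \<in> K"
proof -
  let ?z = "Z Ld ^ 3" and ?w = "average (wd [La, Lb, La, Lc]) :: 'a free" and ?d = "gen Ld :: 'a free"
  define x where "x = const 12 * ?z - const c * ?w - const s"
  have "const c * (?w * ?d - ?d * ?w) = const 12 * (?z * ?d - ?d * ?z) - (x * ?d - ?d * x)"
    unfolding x_def
    by (simp add: algebra_simps const_left_commute[of ?d c] const_left_commute[of ?d 12] gen_const del: const_numeral)
  also have "\<dots> \<in> K" using assms[folded x_def] by (intro diff mult_left mult_right Z_cube_commute_d)
  finally show ?thesis .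
qed

end

section \<open>Leading terms\<close>

definition B_rels :: "'k::field free set" where
  "B_rels = (let a = gen La; b = gen Lb; c = gen Lc; d = gen Ld in
    {a\<^sup>2, b\<^sup>2, c\<^sup>2, d\<^sup>2,
     a * b + b * c + c * a, a * c + c * d + d * a, a * d + b * a + d * b, b * d + c * b + d * c,
     (a + b + c) ^ 6})"

definition T_rels :: "'k::field \<Rightarrow> 'k \<Rightarrow> 'k \<Rightarrow> 'k free set" where
  "T_rels \<alpha>1 \<alpha>2 \<alpha>3 = (let a = gen La; b = gen Lb; c = gen Lc; d = gen Ld in
    {a\<^sup>2 - const \<alpha>1, b\<^sup>2 - const \<alpha>1, c\<^sup>2 - const \<alpha>1, d\<^sup>2 - const \<alpha>1,
     c * a + b * c + a * b - const \<alpha>2, d * a + c * d + a * c - const \<alpha>2,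
     d * b + b * a + a * d - const \<alpha>2, d * c + c * b + b * d - const \<alpha>2,
     (c * b + b * a + a * c - const \<alpha>2) ^ 3 - const \<alpha>3})"

subsection \<open>A functional that vanishes on the relations of B\<close>

definition lin :: "(word \<Rightarrow> 'k) \<Rightarrow> 'k::field free \<Rightarrow> 'k" where
  "lin \<phi> f = (\<Sum>w\<in>Poly_Mapping.keys f. Poly_Mapping.lookup f w * \<phi> w)"

lemma lin_superset:
  assumes "finite W" "Poly_Mapping.keys f \<subseteq> W"
  shows "lin \<phi> f = (\<Sum>w\<in>W. Poly_Mapping.lookup f w * \<phi> w)"
  unfolding lin_def using assms by (intro sum.mono_neutral_left) (auto simp: in_keys_iff)

lemma lin_add: "lin \<phi> (f + g) = lin \<phi> f + lin \<phi> g"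
proof -
  define W where "W = Poly_Mapping.keys f \<union> Poly_Mapping.keys g"
  have W: "finite W" "Poly_Mapping.keys f \<subseteq> W" "Poly_Mapping.keys g \<subseteq> W" "Poly_Mapping.keys (f + g) \<subseteq> W"
    using keys_add[of f g] by (simp_all add: W_def)
  show ?thesis
    unfolding W(2-4)[THEN lin_superset[OF W(1)]] lookup_add distrib_right sum.distrib ..
qed

lemma lin_single: "lin \<phi> (Poly_Mapping.single w r) = r * \<phi> w"
  by (subst lin_superset[of "{w}"]) auto

lemma lin_0: "lin \<phi> 0 = 0"
  by (simp add: lin_def)

lemma lin_const_mult: "lin \<phi> (const r * f) = r * lin \<phi> f"
  by (induction f rule: free_induct) (simp_all add: const_mult_single lin_single lin_add distrib_left)

lemma lin_diff: "lin \<phi> (f - g) = lin \<phi> f - lin \<phi> g"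
  using lin_add[of \<phi> "f - g" g] by simp

datatype state = P0 | P1 | Q0 | Q1 | R0 | R1

text \<open>
  The transpose of a six-dimensional representation of the quadratic relations, found by computer:
  \<open>pull x \<phi> s\<close> is the value of \<open>\<phi>\<close> at \<open>x s\<close>, where every letter maps each basis vector to zero
  or to a basis vector up to sign.
\<close>

fun pull :: "letter \<Rightarrow> (state \<Rightarrow> 'k::field) \<Rightarrow> state \<Rightarrow> 'k" where
  "pull La \<phi> s = (case s of P1 \<Rightarrow> \<phi> Q0 | Q1 \<Rightarrow> \<phi> R0 | R1 \<Rightarrow> \<phi> P0 | _ \<Rightarrow> 0)"
| "pull Lb \<phi> s = (case s of P0 \<Rightarrow> \<phi> Q1 | Q0 \<Rightarrow> \<phi> R0 | R1 \<Rightarrow> \<phi> P1 | _ \<Rightarrow> 0)"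
| "pull Lc \<phi> s = (case s of P0 \<Rightarrow> - \<phi> Q0 | Q1 \<Rightarrow> \<phi> R1 | R0 \<Rightarrow> - \<phi> P1 | _ \<Rightarrow> 0)"
| "pull Ld \<phi> s = (case s of P1 \<Rightarrow> - \<phi> Q1 | Q0 \<Rightarrow> \<phi> R1 | R0 \<Rightarrow> - \<phi> P0 | _ \<Rightarrow> 0)"

lemma pull_add: "pull x (\<lambda>s. \<phi> s + \<psi> s) = (\<lambda>s. pull x \<phi> s + pull x \<psi> s)"
  by (rule ext, cases x) (auto split: state.split)

lemma pull_0: "pull x (\<lambda>s. 0) = (\<lambda>s. 0)"
  by (rule ext, cases x) (auto split: state.split)

lemma fold_pull_add: "fold pull l (\<lambda>s. \<phi> s + \<psi> s) = (\<lambda>s. fold pull l \<phi> s + fold pull l \<psi> s)"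
  by (induction l arbitrary: \<phi> \<psi>) (simp_all add: pull_add)

lemma fold_pull_0: "fold pull l (\<lambda>s. 0) = (\<lambda>s. 0)"
  by (induction l) (simp_all add: pull_0)

text \<open>The coefficient of \<open>R1\<close> in the image of \<open>P0\<close> under the word:
  \<open>fold\<close> applies the transposes from the first letter on, so the last letter acts
  first. The cut-off at length 5 makes the functional vanish in degree 6, hence the representation
  has to respect the quadratic relations only.\<close>

definition degree5_functional :: "word \<Rightarrow> 'k::field" where
  "degree5_functional w =
    (if length (letters w) = 5 then fold pull (letters w) (\<lambda>s. if s = R1 then 1 else 0) P0 else 0)"

text \<open>The largest two-sided ideal in the kernel of the functional; the outer words
  \<open>u\<close> and \<open>v\<close> are what makes it an ideal.\<close>

definition vanishing :: "'k::field free set" where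
  "vanishing = {f. \<forall>u v. lin degree5_functional (wd u * f * wd v) = 0}"

lemma free_ideal_vanishing: "free_ideal vanishing"
proof
  show "0 \<in> vanishing" by (simp add: vanishing_def lin_0)
next
  fix f g :: "'a free" assume "f \<in> vanishing" "g \<in> vanishing"
  then show "f + g \<in> vanishing" by (simp add: vanishing_def distrib_left distrib_right lin_add)
next
  fix f g :: "'a free" assume f: "f \<in> vanishing"
  have "lin degree5_functional (wd u * (g * f) * wd v) = 0" for u v
  proof (induction g rule: free_induct)
    case (single w r)
    have "wd u * (Poly_Mapping.single w r * f) * wd v = const r * (wd (u @ letters w) * f * wd v)"
      unfolding single_Word[of w r] wd_mult[symmetric] by (simp only: mult.assoc const_left_commute)
    then show ?case using f by (simp add: lin_const_mult vanishing_def)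
  qed (simp add: distrib_left distrib_right lin_add)
  then show "g * f \<in> vanishing" by (simp add: vanishing_def)
next
  fix f g :: "'a free" assume f: "f \<in> vanishing"
  have "lin degree5_functional (wd u * (f * g) * wd v) = 0" for u v
  proof (induction g rule: free_induct)
    case (single w r)
    have "wd u * (f * Poly_Mapping.single w r) * wd v = const r * (wd u * f * wd (letters w @ v))"
      unfolding single_Word[of w r] wd_mult[symmetric] by (simp only: mult.assoc const_left_commute)
    then show ?case using f by (simp add: lin_const_mult vanishing_def)
  qed (simp add: distrib_left distrib_right lin_add)
  then show "f * g \<in> vanishing" by (simp add: vanishing_def)
qed

lemma vanishing_square: "gen x * gen x \<in> vanishing"
proof -
  have "pull x (pull x \<phi>) = (\<lambda>s. 0 :: 'a)" for \<phi>
    by (rule ext, cases x) (simp_all split: state.split)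
  then show ?thesis
    by (simp add: vanishing_def gen_eq_wd wd_mult lin_single degree5_functional_def fold_pull_0)
qed

lemma vanishing_triple:
  assumes "\<And>\<phi> s. pull y (pull x \<phi>) s + pull z (pull y \<phi>) s + pull x (pull z \<phi>) s = (0 :: 'k::field)"
  shows "triple x y z \<in> (vanishing :: 'k free set)"
proof -
  have *: "fold pull v (pull y (pull x \<phi>)) s + fold pull v (pull z (pull y \<phi>)) s + fold pull v (pull x (pull z \<phi>)) s = (0 :: 'k)"
    for v s \<phi>
    using fun_cong[OF fold_pull_0[of v], of s] assms[of \<phi>] by (simp flip: fun_cong[OF fold_pull_add])
  show ?thesis unfolding vanishing_def mem_Collect_eq
  proof (intro allI)
    fix u v
    have "wd u * triple x y z * wd v = wd (u @ x # y # v) + wd (u @ y # z # v) + (wd (u @ z # x # v) :: 'k free)"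
      by (simp add: triple_def distrib_left distrib_right gen_eq_wd wd_mult)
    \<comment> \<open>The three words have equal length, so the cut-off keeps all of them or
      none.\<close>
    then show "lin degree5_functional (wd u * triple x y z * wd v) = (0 :: 'k)"
      using * by (simp add: lin_add lin_single degree5_functional_def)
  qed
qed

lemma homogeneous_power: "f \<in> homogeneous m \<Longrightarrow> f ^ n \<in> homogeneous (m * n)"
proof (induction n)
  case 0
  show ?case using const_degree(1)[of 1] by simp
next
  case (Suc n)
  then show ?case using degree_mult(4)[of f m "f ^ n" "m * n"] by simp
qed

lemma vanishing_homogeneous:
  assumes "f \<in> homogeneous m" "m > 5"
  shows "f \<in> vanishing"
  unfolding vanishing_def mem_Collect_eq
proof (intro allI)
  fix u v
  have "wd u * f * wd v \<in> homogeneous (length u + m + length v)"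
    using assms(1) by (intro degree_mult(4) single_degree(3)) simp_all
  then have "degree5_functional w = (0 :: 'a)" if "w \<in> Poly_Mapping.keys (wd u * f * wd v)" for w
    using that assms(2) by (auto simp: homogeneous_def degree5_functional_def)
  then show "lin degree5_functional (wd u * f * wd v) = 0" by (simp add: lin_def)
qed

lemma B_rels_vanishing: "ideal_span B_rels \<subseteq> (vanishing :: 'k::field free set)"
proof -
  interpret free_ideal "vanishing :: 'k free set" by (rule free_ideal_vanishing)
  have t: "triple La Lb Lc \<in> (vanishing :: 'k free set)" "triple La Lc Ld \<in> (vanishing :: 'k free set)"
    "triple La Ld Lb \<in> (vanishing :: 'k free set)" "triple Lb Ld Lc \<in> (vanishing :: 'k free set)"
    by (rule vanishing_triple; simp split: state.split)+
  have "gen La + gen Lb + gen Lc \<in> (homogeneous 1 :: 'k free set)"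
    by (intro degree_add_closed gen_degree)
  from homogeneous_power[OF this, of 6]
  have "(gen La + gen Lb + gen Lc) ^ 6 \<in> (vanishing :: 'k free set)"
    by (rule vanishing_homogeneous) simp
  then have "B_rels \<subseteq> (vanishing :: 'k free set)"
    using t by (simp add: B_rels_def Let_def triple_def vanishing_square power2_eq_square add_ac)
  then show ?thesis by (rule span_subset)
qed

text \<open>An evaluation on 24 words of length 5. The value 1 is the same over every field, so
  applying the functional to \<open>c\<close> times the commutator returns \<open>c\<close>.\<close>

lemma commutator_functional:
  "lin degree5_functional (average (wd [La, Lb, La, Lc]) * gen Ld - gen Ld * average (wd [La, Lb, La, Lc])) = (1 :: 'k::field)"
  unfolding average_def relabel_wd list.map quad_simps
  unfolding gen_eq_wd distrib_left distrib_right wd_mult append.simps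
  unfolding lin_add lin_diff lin_single
  by (simp add: degree5_functional_def)

subsection \<open>The sixth power of a + b + c\<close>

definition cubic_base :: "'k::field \<Rightarrow> 'k free" where
  "cubic_base \<beta> = gen Lc * gen Lb + gen Lb * gen La + gen La * gen Lc - const \<beta>"

lemma cube_cong:
  assumes "free_ideal K" "x - y \<in> K"
  shows "x ^ 3 - y ^ 3 \<in> K"
proof -
  interpret free_ideal K by fact
  have "x ^ 3 - y ^ 3 = (x - y) * x * x + y * (x - y) * x + y * y * (x - y)"
    by (simp add: power3_eq_cube algebra_simps)
  also have "\<dots> \<in> K" using assms(2) by (simp only: add mult_left mult_right)
  finally show ?thesis .
qed

text \<open>The square of $a + b + c$ consists of three squares, the triple $ab + bc + ca$ and the
  remaining $cb + ba + ac$; modulo \<open>K\<close> this is \<open>cubic_base \<beta>\<close> plus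
  $3 \<alpha> + 2 \<beta>$. Cubing gives the claim.\<close>

lemma sixth_power:
  fixes \<alpha> \<beta> :: "'k::field"
  defines "\<kappa> \<equiv> const \<alpha> + const \<alpha> + const \<alpha> + const \<beta> + const \<beta>"
  assumes "free_ideal K"
    and "\<And>x. gen x * gen x - const \<alpha> \<in> K" "triple La Lb Lc - const \<beta> \<in> K"
  shows "(gen La + gen Lb + gen Lc) ^ 6 - (cubic_base \<beta> + \<kappa>) ^ 3 \<in> K"
proof -
  interpret free_ideal K by fact
  let ?t = "gen La + gen Lb + gen Lc :: 'k free"
  have "?t * ?t - (cubic_base \<beta> + \<kappa>) = (gen La * gen La - const \<alpha>) + (gen Lb * gen Lb - const \<alpha>)
    + (gen Lc * gen Lc - const \<alpha>) + (triple La Lb Lc - const \<beta>)"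
    by (simp add: cubic_base_def \<kappa>_def triple_def algebra_simps)
  also have "\<dots> \<in> K" by (intro add assms(3,4))
  finally have "(?t * ?t) ^ 3 - (cubic_base \<beta> + \<kappa>) ^ 3 \<in> K" by (rule cube_cong[OF assms(2)])
  then show ?thesis by (simp flip: power2_eq_square power_mult)
qed

lemma degree_le_less: "f \<in> degree_le m \<Longrightarrow> m < n \<Longrightarrow> f \<in> degree_less n"
  using degree_less_mono[of f "Suc m" n] by (simp add: degree_less_Suc)

lemma cubic_base_degree: "cubic_base \<beta> \<in> degree_le 2"
  unfolding cubic_base_def one_add_one[symmetric]
  by (intro degree_add_closed degree_diff_closed degree_mult(1) homogeneous_degree_le[OF gen_degree] const_degree)

lemma cubic_shift_degree:
  assumes "k \<in> degree_le 0"
  shows "(cubic_base \<beta> + k) ^ 3 - cubic_base \<beta> ^ 3 \<in> degree_le 4"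
proof -
  let ?w = "cubic_base \<beta>"
  have k2: "?w + k \<in> degree_le 2"
    using assms by (intro degree_add_closed cubic_base_degree) (auto simp: degree_le_def)
  have "k * (?w + k) * (?w + k) \<in> degree_le (0 + 2 + 2)"
    "?w * k * (?w + k) \<in> degree_le (2 + 0 + 2)" "?w * ?w * k \<in> degree_le (2 + 2 + 0)"
    by (intro degree_mult(1) assms k2 cubic_base_degree)+
  then have *: "k * (?w + k) * (?w + k) \<in> degree_le 4"
    "?w * k * (?w + k) \<in> degree_le 4" "?w * ?w * k \<in> degree_le 4"
    unfolding add_0_left add_0_right numeral_plus_numeral add_num_simps by this+
  have "(?w + k) ^ 3 - ?w ^ 3 = k * (?w + k) * (?w + k) + ?w * k * (?w + k) + ?w * ?w * k"
    by (simp add: power3_eq_cube algebra_simps)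
  also have "\<dots> \<in> degree_le 4" by (intro degree_add_closed *)
  finally show ?thesis .
qed

subsection \<open>Leading terms of the relations of T\<close>

lemma component_mult_left:
  "component m (Poly_Mapping.single w r * f) =
    (if length (letters w) \<le> m then Poly_Mapping.single w r * component (m - length (letters w)) f else 0)"
  by (induction f rule: free_induct)
     (auto simp: mult_single restrict_words_single distrib_left restrict_words_add)

lemma component_mult_right:
  "component m (f * Poly_Mapping.single w r) =
    (if length (letters w) \<le> m then component (m - length (letters w)) f * Poly_Mapping.single w r else 0)"
  by (induction f rule: free_induct)
     (auto simp: mult_single restrict_words_single distrib_right restrict_words_add)

text \<open>The ideal of leading forms of \<open>J\<close>. Testing every homogeneous component
  separately admits inhomogeneous elements, so that the set is an ideal and can be compared with
  \<open>ideal_span B_rels\<close> on generators.\<close>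

definition lead_ideal :: "'k::field free set \<Rightarrow> 'k free set" where
  "lead_ideal J = {f. \<forall>m. \<exists>j\<in>J. component m f - j \<in> degree_less m}"

lemma free_ideal_lead_ideal:
  assumes "free_ideal J"
  shows "free_ideal (lead_ideal J)"
proof -
  interpret J: free_ideal J by fact
  have zero: "0 \<in> lead_ideal J" by (auto simp: lead_ideal_def intro!: bexI[of _ 0])
  have add: "f + g \<in> lead_ideal J" if f: "f \<in> lead_ideal J" and g: "g \<in> lead_ideal J" for f g
    unfolding lead_ideal_def mem_Collect_eq
  proof
    fix m
    obtain i where "i \<in> J" "component m f - i \<in> degree_less m"
      using f unfolding lead_ideal_def by blast
    moreover obtain j where "j \<in> J" "component m g - j \<in> degree_less m"
      using g unfolding lead_ideal_def by blast
    ultimately show "\<exists>j\<in>J. component m (f + g) - j \<in> degree_less m"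
      using degree_add_closed(1)[of "component m f - i" m "component m g - j"]
      by (intro bexI[of _ "i + j"]) (simp_all add: J.add restrict_words_add add_diff_add)
  qed
  have left: "g * f \<in> lead_ideal J" if f: "f \<in> lead_ideal J" for f g
  proof (induction g rule: free_induct)
    case (single w r)
    show ?case unfolding lead_ideal_def mem_Collect_eq
    proof
      fix m
      let ?n = "length (letters w)" and ?w = "Poly_Mapping.single w r"
      \<comment> \<open>If the word is longer than \<open>m\<close>, the truncated subtraction
        yields an irrelevant \<open>j\<close>; the component of the product is then zero and 0 is
        the witness.\<close>
      obtain j where j: "j \<in> J" "component (m - ?n) f - j \<in> degree_less (m - ?n)"
        using f unfolding lead_ideal_def by blast
      show "\<exists>j\<in>J. component m (?w * f) - j \<in> degree_less m"
      proof (cases "?n \<le> m")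
        case True
        have "?w * (component (m - ?n) f - j) \<in> degree_less (?n + (m - ?n))"
          by (rule degree_mult(2)[OF single_degree(1) j(2)]) simp
        then show ?thesis using True j(1)
          by (intro bexI[of _ "?w * j"]) (simp_all add: component_mult_left right_diff_distrib J.mult_left)
      qed (auto simp: component_mult_left intro!: bexI[of _ 0])
    qed
  qed (simp add: distrib_right add)
  have right: "f * g \<in> lead_ideal J" if f: "f \<in> lead_ideal J" for f g
  proof (induction g rule: free_induct)
    case (single w r)
    show ?case unfolding lead_ideal_def mem_Collect_eq
    proof
      fix m
      let ?n = "length (letters w)" and ?w = "Poly_Mapping.single w r"
      obtain j where j: "j \<in> J" "component (m - ?n) f - j \<in> degree_less (m - ?n)"
        using f unfolding lead_ideal_def by blast
      show "\<exists>j\<in>J. component m (f * ?w) - j \<in> degree_less m"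
      proof (cases "?n \<le> m")
        case True
        have "(component (m - ?n) f - j) * ?w \<in> degree_less (m - ?n + ?n)"
          by (rule degree_mult(3)[OF j(2) single_degree(1)]) simp
        then show ?thesis using True j(1)
          by (intro bexI[of _ "j * ?w"]) (simp_all add: component_mult_right left_diff_distrib J.mult_right)
      qed (auto simp: component_mult_right intro!: bexI[of _ 0])
    qed
  qed (simp add: distrib_left add)
  show ?thesis by standard (fact zero add left right)+
qed

lemma lead_ideal_homogeneous:
  assumes "f \<in> homogeneous m" "j \<in> J" "f - j \<in> degree_less m" "free_ideal J"
  shows "f \<in> lead_ideal J"
  unfolding lead_ideal_def mem_Collect_eq
proof
  fix n
  have "0 \<in> J" using assms(4) by (simp add: free_ideal.zero)
  then show "\<exists>j\<in>J. component n f - j \<in> degree_less n"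
    using assms by (cases "n = m") (auto simp: component_of_homogeneous intro: bexI[of _ 0])
qed

lemma gen_mult_degree: "gen x * gen y \<in> homogeneous 2"
  unfolding one_add_one[symmetric] by (intro degree_mult(4) gen_degree)

lemma const_degree_less: "m > 0 \<Longrightarrow> const r \<in> degree_less m"
  by (simp add: const_def single_degree)

text \<open>Every generator of the ideal of $B$ is the leading form of an element of
  \<open>J\<close>. For the squares and triples this is visible; for the sixth power it rests on
  \<open>sixth_power\<close>.\<close>

lemma B_rels_lead_ideal:
  fixes \<alpha> \<beta> \<gamma> :: "'k::field"
  defines "J \<equiv> ideal_span (T_rels \<alpha> \<beta> \<gamma>)"
  shows "ideal_span B_rels \<subseteq> lead_ideal J"
proof -
  have J: "free_ideal J" unfolding J_def by (rule free_ideal_span)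
  interpret J: free_ideal J by (rule J)
  interpret free_ideal "lead_ideal J" by (rule free_ideal_lead_ideal[OF J])
  have T: "T_rels \<alpha> \<beta> \<gamma> \<subseteq> J" unfolding J_def using ideal_span.base by blast
  have sq: "gen x * gen x - const \<alpha> \<in> J" for x
    using T by (cases x) (simp_all add: T_rels_def Let_def power2_eq_square)
  have tr: "triple La Lb Lc - const \<beta> \<in> J" "triple La Lc Ld - const \<beta> \<in> J"
    "triple La Ld Lb - const \<beta> \<in> J" "triple Lb Ld Lc - const \<beta> \<in> J"
    using T by (simp_all add: T_rels_def Let_def triple_def add_ac)
  have cube: "cubic_base \<beta> ^ 3 - const \<gamma> \<in> J"
    using T by (simp add: T_rels_def Let_def cubic_base_def)
  have S: "gen x * gen x \<in> lead_ideal J" for x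
    by (rule lead_ideal_homogeneous[OF gen_mult_degree sq[of x] _ J]) (simp add: const_degree_less)
  have H: "triple x y z \<in> homogeneous 2" for x y z
    unfolding triple_def by (intro degree_add_closed gen_mult_degree)
  have Tr: "triple x y z \<in> lead_ideal J" if "triple x y z - const \<beta> \<in> J" for x y z
    by (rule lead_ideal_homogeneous[OF H that _ J]) (simp add: const_degree_less)
  define k where "k = const \<alpha> + const \<alpha> + const \<alpha> + const \<beta> + const \<beta>"
  have k: "k \<in> degree_le 0" unfolding k_def by (intro degree_add_closed const_degree)
  let ?t = "(gen La + gen Lb + gen Lc) ^ 6 :: 'k free"
  have "gen La + gen Lb + gen Lc \<in> (homogeneous 1 :: 'k free set)"
    by (intro degree_add_closed gen_degree)
  from homogeneous_power[OF this, of 6] have h6: "?t \<in> homogeneous 6" by simp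
  have "?t - (cubic_base \<beta> + k) ^ 3 \<in> J" unfolding k_def by (rule sixth_power[OF J sq tr(1)])
  \<comment> \<open>The correction by \<open>cubic_base \<beta> ^ 3 - const \<gamma>\<close> cancels
    the leading part of the cube: what separates this element from \<open>?t\<close> has degree at
    most 4.\<close>
  from J.add[OF this cube] have j: "?t - (cubic_base \<beta> + k) ^ 3 + (cubic_base \<beta> ^ 3 - const \<gamma>) \<in> J" .
  have "?t - (?t - (cubic_base \<beta> + k) ^ 3 + (cubic_base \<beta> ^ 3 - const \<gamma>))
    = ((cubic_base \<beta> + k) ^ 3 - cubic_base \<beta> ^ 3) + const \<gamma>" by (simp add: algebra_simps)
  also have "\<dots> \<in> degree_less 6"
    by (intro degree_add_closed const_degree_less degree_le_less[OF cubic_shift_degree[OF k]]) simp_all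
  finally have "?t \<in> lead_ideal J" using lead_ideal_homogeneous[OF h6 j _ J] by blast
  then have "B_rels \<subseteq> lead_ideal J"
    using S Tr[OF tr(1)] Tr[OF tr(2)] Tr[OF tr(3)] Tr[OF tr(4)]
    by (simp add: B_rels_def Let_def triple_def power2_eq_square add_ac)
  then show ?thesis by (rule span_subset)
qed

section \<open>Ideals with the leading terms of B\<close>

text \<open>The assumption \<open>leading\<close> is the PBW property stated inside the free
  algebra: the ideal of $B$ consists, degree by degree, of the leading forms of
  \<open>K\<close>.\<close>

locale deformation_ideal = stable_ideal K for K :: "'k::field free set" +
  assumes two: "(2 :: 'k) \<noteq> 0" and three: "(3 :: 'k) \<noteq> 0"
    and leading: "f \<in> homogeneous m \<Longrightarrow> f \<in> ideal_span B_rels \<longleftrightarrow> (\<exists>h\<in>degree_less m. f + h \<in> K)"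
begin

text \<open>The lower part of a lift has degree at most 1. Adding the image under the sign doubles
  \<open>f\<close> and cancels the linear part, so that only the coefficient of the empty word is
  left.\<close>

lemma quadratic_lift:
  assumes "f \<in> homogeneous 2" "f \<in> ideal_span B_rels" "negate f = f"
  obtains \<alpha> where "f - const \<alpha> \<in> K"
proof -
  obtain h where h: "h \<in> degree_less 2" "f + h \<in> K" using leading[OF assms(1)] assms(2) by blast
  have "even_part h = const (Poly_Mapping.lookup h 0)"
  proof (rule poly_mapping_eqI)
    fix w
    obtain l where w: "w = Word l" by (cases w)
    show "Poly_Mapping.lookup (even_part h) w = Poly_Mapping.lookup (const (Poly_Mapping.lookup h 0)) w"
    proof (cases l)
      case Nil
      then show ?thesis using w by (simp add: restrict_words.rep_eq const_def zero_word_def)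
    next
      case (Cons x l')
      have "length (letters w) < 2" if "w \<in> Poly_Mapping.keys h"
        using h(1) that by (simp add: degree_less_def)
      then have "Poly_Mapping.lookup h w = 0 \<or> length l < 2" using w by (auto simp: in_keys_iff)
      then show ?thesis using w Cons
        by (cases l') (auto simp: restrict_words.rep_eq const_def zero_word_def lookup_single when_def)
    qed
  qed
  moreover have "f + negate h \<in> K" using negate[OF h(2)] by (simp add: subst_add assms(3))
  from add[OF h(2) this] have "const 2 * f + (h + negate h) \<in> K" by (simp add: mult_2 algebra_simps)
  then have "const 2 * (f + even_part h) \<in> K" by (simp only: add_negate distrib_left)
  then have "f + even_part h \<in> K" by (rule const_cancel[OF _ two])
  ultimately show thesis using that[of "- Poly_Mapping.lookup h 0"] by (simp add: const_minus)
qed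

theorem eq_T_ideal: "\<exists>\<alpha> \<beta> \<gamma>. K = ideal_span (T_rels \<alpha> \<beta> \<gamma>)"
proof -
  have B: "B_rels \<subseteq> ideal_span (B_rels :: 'k free set)" using ideal_span.base by blast
  have "negate ((gen La)\<^sup>2) = (gen La)\<^sup>2" by (simp add: power2_eq_square subst_mult)
  moreover have "(gen La)\<^sup>2 \<in> homogeneous 2" by (simp add: power2_eq_square gen_mult_degree)
  moreover have "(gen La)\<^sup>2 \<in> ideal_span (B_rels :: 'k free set)" using B by (simp add: B_rels_def Let_def)
  ultimately obtain \<alpha> where \<alpha>: "(gen La)\<^sup>2 - const \<alpha> \<in> K" using quadratic_lift by metis
  have "negate (triple La Lb Lc) = triple La Lb Lc" by (simp add: triple_def subst_add subst_mult)
  moreover have "triple La Lb Lc \<in> homogeneous 2"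
    unfolding triple_def by (intro degree_add_closed gen_mult_degree)
  moreover have "triple La Lb Lc \<in> ideal_span (B_rels :: 'k free set)"
    using B by (simp add: B_rels_def Let_def triple_def)
  ultimately obtain \<beta> where \<beta>: "triple La Lb Lc - const \<beta> \<in> K" using quadratic_lift by metis
  interpret quadratic_ideal_char K \<alpha> \<beta>
    by standard (fact \<alpha> \<beta> two three)+
  let ?w = "cubic_base \<beta> :: 'k free" and ?t = "(gen La + gen Lb + gen Lc) ^ 6 :: 'k free"
  define k where "k = const \<alpha> + const \<alpha> + const \<alpha> + const \<beta> + const \<beta>"
  have k: "k \<in> degree_le 0" unfolding k_def by (intro degree_add_closed const_degree)
  have "gen La + gen Lb + gen Lc \<in> (homogeneous 1 :: 'k free set)"
    by (intro degree_add_closed gen_degree)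
  from homogeneous_power[OF this, of 6] have "?t \<in> homogeneous 6" by simp
  moreover have "?t \<in> ideal_span B_rels" using B by (simp add: B_rels_def Let_def)
  ultimately obtain h where h: "h \<in> degree_less 6" "?t + h \<in> K" using leading by blast
  have t: "?t - (?w + k) ^ 3 \<in> K"
    unfolding k_def by (rule sixth_power[OF free_ideal_axioms square triple_abc])
  have zw: "Z Ld ^ 3 - ?w ^ 3 \<in> K"
    using cube_cong[OF free_ideal_axioms Z_d_alt] by (simp add: cubic_base_def)
  \<comment> \<open>From $t^6 + h$ and $t^6 - (w + k)^3$ in \<open>K\<close>, with $t = a + b + c$,
    the cube $w^3$ is congruent to this \<open>h'\<close>, and so is $Z_d^3$.\<close>
  define h' where "h' = - h - ((?w + k) ^ 3 - ?w ^ 3)"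
  have "h' \<in> degree_le 5"
  proof -
    have "(?w + k) ^ 3 - ?w ^ 3 \<in> degree_less 6"
      by (rule degree_le_less[OF cubic_shift_degree[OF k]]) simp
    then have "h' \<in> degree_less 6"
      unfolding h'_def using h(1) by (intro degree_diff_closed(1)[OF degree_minus_closed])
    then show ?thesis by (auto simp: degree_less_def degree_le_def dest!: bspec)
  qed
  moreover have "Z Ld ^ 3 - h' \<in> K"
    using add[OF zw diff[OF h(2) t]] by (simp add: h'_def algebra_simps)
  ultimately obtain c s where cs: "const 12 * Z Ld ^ 3 - const c * average (wd [La, Lb, La, Lc]) - const s \<in> K"
    using Z_cube_average by blast
  let ?com = "average (wd [La, Lb, La, Lc]) * gen Ld - gen Ld * average (wd [La, Lb, La, Lc]) :: 'k free"
  have "const c * ?com \<in> homogeneous (0 + 5)"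
  proof (intro degree_mult(4) const_degree)
    have w4: "average (wd [La, Lb, La, Lc]) \<in> (homogeneous 4 :: 'k free set)"
      unfolding average_def relabel_wd by (intro degree_add_closed single_degree) simp_all
    from degree_mult(4)[OF w4 gen_degree, of Ld] degree_mult(4)[OF gen_degree w4, of Ld]
    have "average (wd [La, Lb, La, Lc]) * gen Ld \<in> (homogeneous 5 :: 'k free set)"
      "gen Ld * average (wd [La, Lb, La, Lc]) \<in> (homogeneous 5 :: 'k free set)" by simp_all
    then show "?com \<in> homogeneous 5"
      unfolding homogeneous_def using keys_diff_free by blast
  qed
  moreover have "const c * ?com + 0 \<in> K" using average_commutator[OF cs] by simp
  \<comment> \<open>The element is homogeneous of degree 5 and lies in \<open>K\<close>, so
    \<open>leading\<close> with lower part 0 puts it into the ideal of $B$, where the functional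
    vanishes.\<close>
  ultimately have "const c * ?com \<in> ideal_span B_rels" using leading zero_in_degree(1) by blast
  then have "const c * ?com \<in> vanishing" using B_rels_vanishing by blast
  then have "lin degree5_functional (wd [] * (const c * ?com) * wd []) = 0"
    unfolding vanishing_def mem_Collect_eq by blast
  then have "c = 0" by (simp add: wd_Nil lin_const_mult commutator_functional)
  have twelve: "(12 :: 'k) \<noteq> 0"
  proof -
    have "(12 :: 'k) = 2 * 2 * 3" by simp
    then show ?thesis using two three by (metis mult_eq_0_iff)
  qed
  define \<gamma> where "\<gamma> = s / 12"
  have "const 12 * (Z Ld ^ 3 - const \<gamma>) \<in> K"
    using cs \<open>c = 0\<close> twelve by (simp add: right_diff_distrib \<gamma>_def flip: const_mult const_numeral)
  then have "Z Ld ^ 3 - const \<gamma> \<in> K" by (rule const_cancel[OF _ twelve])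
  from diff[OF this zw] have cube: "?w ^ 3 - const \<gamma> \<in> K" by simp
  let ?J = "ideal_span (T_rels \<alpha> \<beta> \<gamma>)"
  have "T_rels \<alpha> \<beta> \<gamma> \<subseteq> K"
    using square triples cube
    by (simp add: T_rels_def Let_def triple_def cubic_base_def power2_eq_square add_ac)
  then have JK: "?J \<subseteq> K" by (rule span_subset)
  interpret J: free_ideal ?J by (rule free_ideal_span)
  \<comment> \<open>Descent on a strict degree bound: the top component of \<open>f\<close> lies in
    the ideal of $B$ by \<open>leading\<close>, hence is the leading form of some \<open>j\<close>
    in \<open>?J\<close>. As \<open>?J\<close> is contained in \<open>K\<close>, the difference
    \<open>f - j\<close> is again in \<open>K\<close> and of smaller degree.\<close>
  have "f \<in> ?J" if "f \<in> K" "f \<in> degree_less m" for f m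
    using that
  proof (induction m arbitrary: f)
    case 0
    then show ?case using J.zero by simp
  next
    case (Suc m)
    let ?c = "component m f"
    have low: "f - ?c \<in> degree_less m" using Suc.prems(2) by (rule degree_less_iff_component)
    moreover have "?c + (f - ?c) \<in> K" using Suc.prems(1) by simp
    ultimately have "?c \<in> ideal_span B_rels" using leading[OF component_homogeneous] by blast
    then have "?c \<in> lead_ideal ?J" using B_rels_lead_ideal by blast
    then obtain j where j: "j \<in> ?J" "?c - j \<in> degree_less m"
      by (auto simp: lead_ideal_def component_of_homogeneous[OF component_homogeneous] dest: spec[of _ m])
    have "f - j \<in> degree_less m" using degree_add_closed(1)[OF low j(2)] by simp
    moreover have "f - j \<in> K" using Suc.prems(1) j(1) JK by (intro diff) auto
    ultimately have "f - j \<in> ?J" by (intro Suc.IH)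
    from J.add[OF this j(1)] show ?case by simp
  qed
  then have "K \<subseteq> ?J" using exists_degree_le degree_less_Suc by blast
  then show ?thesis using JK by blast
qed

end

section \<open>The associated graded algebra\<close>

locale filtered_algebra = ring A for A :: "('k::field, 'a) galgebra" (structure) +
  assumes filtered: "filtered_G_algebra A"
begin

lemmas piece_act = filtered_G_algebra.piece_act[OF filtered]
  and piece_mono = filtered_G_algebra.piece_mono[OF filtered]
  and piece_one = filtered_G_algebra.piece_one[OF filtered]
  and piece_mult = filtered_G_algebra.piece_mult[OF filtered]
  and piece_exhaustive = filtered_G_algebra.piece_exhaustive[OF filtered]

lemma G_algebra: "G_algebra A"
  using filtered by (simp add: filtered_G_algebra_def)

lemma module: "module (ring_of_type_algebra :: 'k ring) A"
  using G_algebra by (simp add: G_algebra_def)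

lemma smult:
  "x \<in> carrier A \<Longrightarrow> r \<odot> x \<in> carrier A"
  "x \<in> carrier A \<Longrightarrow> (r + s) \<odot> x = r \<odot> x \<oplus> s \<odot> x"
  "x \<in> carrier A \<Longrightarrow> y \<in> carrier A \<Longrightarrow> r \<odot> (x \<oplus> y) = r \<odot> x \<oplus> r \<odot> y"
  "x \<in> carrier A \<Longrightarrow> (r * s) \<odot> x = r \<odot> (s \<odot> x)"
  "x \<in> carrier A \<Longrightarrow> 1 \<odot> x = x"
  using module.smult_closed[OF module, of r x] module.smult_l_distr[OF module, of r s x]
    module.smult_r_distr[OF module, of r x y] module.smult_assoc1[OF module, of r s x] module.smult_one[OF module, of x]
  by (simp_all add: ring_of_type_algebra_def)

lemmas smult_mult_left = G_algebra.smult_mult_left[OF G_algebra]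
  and smult_mult_right = G_algebra.smult_mult_right[OF G_algebra]
  and act_smult = G_algebra.act_smult[OF G_algebra]

lemma act_hom:
  "x \<in> carrier A \<Longrightarrow> act A g x \<in> carrier A"
  "x \<in> carrier A \<Longrightarrow> y \<in> carrier A \<Longrightarrow> act A g (x \<otimes> y) = act A g x \<otimes> act A g y"
  "x \<in> carrier A \<Longrightarrow> y \<in> carrier A \<Longrightarrow> act A g (x \<oplus> y) = act A g x \<oplus> act A g y"
  "act A g \<one> = \<one>"
  using G_algebra.act_ring_hom[OF G_algebra, of g] by (auto simp: ring_hom_def)

lemma act_mult:
  assumes "x \<in> carrier A"
  shows "act A (tgroup_mult g h) x = act A g (act A h x)"
proof -
  interpret group_action tetG "carrier A" "\<lambda>g. restrict (act A g) (carrier A)"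
    by (rule G_algebra.group_action[OF G_algebra])
  show ?thesis
    using composition_rule[OF assms, of g h] assms act_hom(1) by (simp add: tetG_def)
qed

lemma act_one:
  assumes "x \<in> carrier A"
  shows "act A tgroup_one x = x"
proof -
  interpret group_action tetG "carrier A" "\<lambda>g. restrict (act A g) (carrier A)"
    by (rule G_algebra.group_action[OF G_algebra])
  show ?thesis using id_eq_one assms by (simp add: tetG_def fun_eq_iff restrict_def) metis
qed

lemma piece_submodule: "submodule (piece A m) (ring_of_type_algebra :: 'k ring) A"
  by (rule filtered_G_algebra.piece_submodule[OF filtered])

lemma piece_subgroup: "subgroup (piece A m) (add_monoid A)"
  using piece_submodule[of m] by (simp add: submodule_def)

lemma piece_carrier: "x \<in> piece A m \<Longrightarrow> x \<in> carrier A"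
  using subgroup.mem_carrier[OF piece_subgroup] by simp

lemma piece_smult: "x \<in> piece A m \<Longrightarrow> r \<odot> x \<in> piece A m"
  using submodule.smult_closed[OF piece_submodule, of r] by (simp add: ring_of_type_algebra_def)

lemma lower_subgroup: "subgroup (lower A m) (add_monoid A)"
  using piece_subgroup by (cases m) (simp_all add: lower_def add.triv_subgroup)

lemma lower_piece: "x \<in> lower A m \<Longrightarrow> x \<in> piece A m"
  using piece_mono[of "m - 1" m] subgroup.one_closed[OF piece_subgroup[of 0]]
  by (cases m) (auto simp: lower_def)

lemma lower_smult: "x \<in> lower A m \<Longrightarrow> r \<odot> x \<in> lower A m"
proof (cases m)
  case 0
  have "r \<odot> \<zero> \<oplus> r \<odot> \<zero> = r \<odot> \<zero>" using smult(3)[of \<zero> \<zero> r] by simp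
  then have "r \<odot> \<zero> = \<zero>" using smult(1)[of \<zero> r] by (metis add.l_cancel_one' zero_closed)
  then show "x \<in> lower A m \<Longrightarrow> r \<odot> x \<in> lower A m" using 0 by (simp add: lower_def)
qed (simp add: lower_def piece_smult)

lemma lower_act: "x \<in> lower A m \<Longrightarrow> act A g x \<in> lower A m"
proof (cases m)
  case 0
  have "act A g \<zero> \<oplus> act A g \<zero> = act A g \<zero>" using act_hom(3)[of \<zero> \<zero> g] by simp
  then have "act A g \<zero> = \<zero>" using act_hom(1)[of \<zero> g] by (metis add.l_cancel_one' zero_closed)
  then show "x \<in> lower A m \<Longrightarrow> act A g x \<in> lower A m" using 0 by (simp add: lower_def)
qed (simp add: lower_def piece_act)

lemma lower_mult:
  "x \<in> lower A m \<Longrightarrow> y \<in> piece A n \<Longrightarrow> x \<otimes> y \<in> lower A (m + n)"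
  "x \<in> piece A m \<Longrightarrow> y \<in> lower A n \<Longrightarrow> x \<otimes> y \<in> lower A (m + n)"
  using piece_mult[of x "m - 1" y n] piece_mult[of x m y "n - 1"]
    subgroup.one_closed[OF lower_subgroup[of "m + n"]] piece_carrier[of y n] piece_carrier[of x m]
  by (cases m; cases n; auto simp: lower_def)+

lemma lower_carrier: "x \<in> lower A m \<Longrightarrow> x \<in> carrier A"
  using lower_piece piece_carrier by blast

lemma piece_closed:
  "x \<in> piece A m \<Longrightarrow> y \<in> piece A m \<Longrightarrow> x \<oplus> y \<in> piece A m"
  "x \<in> piece A m \<Longrightarrow> y \<in> piece A m \<Longrightarrow> x \<ominus> y \<in> piece A m"
  "\<zero> \<in> piece A m"
  "x \<in> piece A m \<Longrightarrow> \<ominus> x \<in> piece A m"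
  using subgroup.m_closed[OF piece_subgroup, of x m] subgroup.one_closed[OF piece_subgroup, of m]
    subgroup.m_inv_closed[OF piece_subgroup, of _ m]
  by (auto simp: a_minus_def a_inv_def)

lemma lower_closed:
  "x \<in> lower A m \<Longrightarrow> y \<in> lower A m \<Longrightarrow> x \<oplus> y \<in> lower A m"
  "\<zero> \<in> lower A m"
  "x \<in> lower A m \<Longrightarrow> \<ominus> x \<in> lower A m"
  using subgroup.m_closed[OF lower_subgroup, of x m] subgroup.one_closed[OF lower_subgroup, of m]
    subgroup.m_inv_closed[OF lower_subgroup, of _ m]
  by (auto simp: a_inv_def)

abbreviation coset :: "nat \<Rightarrow> 'a \<Rightarrow> 'a set" where
  "coset m x \<equiv> lower A m +> x"

lemma in_coset_iff: "z \<in> coset m x \<longleftrightarrow> (\<exists>h\<in>lower A m. z = h \<oplus> x)"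
  by (auto simp: a_r_coset_def')

lemma coset_lower: "x \<in> lower A m \<Longrightarrow> coset m x = lower A m"
  using add.coset_join2[of x "lower A m"] lower_subgroup lower_carrier by (simp add: a_r_coset_def)

lemma coset_shift: "h \<in> lower A m \<Longrightarrow> x \<in> carrier A \<Longrightarrow> coset m (h \<oplus> x) = coset m x"
  using add.coset_mult_assoc[of "lower A m" h x] add.coset_join2[of h "lower A m"] lower_subgroup lower_carrier
  by (auto simp: a_r_coset_def)

lemma coset_eq_lower_iff: "x \<in> carrier A \<Longrightarrow> coset m x = lower A m \<longleftrightarrow> x \<in> lower A m"
  using add.coset_join1[of "lower A m" x] lower_subgroup coset_lower lower_carrier
  by (auto simp: a_r_coset_def)

lemma coset_self: "x \<in> carrier A \<Longrightarrow> x \<in> coset m x"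
  using lower_closed(2) by (force simp: in_coset_iff)

text \<open>A family of equal cosets, indexed by a coset, is written as a union in the definitions.\<close>

lemma UN_coset:
  assumes "x \<in> carrier A" "\<And>h. h \<in> lower A m \<Longrightarrow> F (h \<oplus> x) = C"
  shows "(\<Union>z\<in>coset m x. F z) = C"
proof -
  have "F z = C" if "z \<in> coset m x" for z using that assms(2) by (auto simp: in_coset_iff)
  then show ?thesis using coset_self[OF assms(1), of m] by auto
qed

lemma induced_coset:
  assumes "x \<in> carrier A" "\<And>x. x \<in> carrier A \<Longrightarrow> f x \<in> carrier A"
    and "\<And>x y. x \<in> carrier A \<Longrightarrow> y \<in> carrier A \<Longrightarrow> f (x \<oplus> y) = f x \<oplus> f y"
    and "\<And>h. h \<in> lower A m \<Longrightarrow> f h \<in> lower A m"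
  shows "induced A (lower A m) f (coset m x) = coset m (f x)"
  unfolding induced_def
  by (rule UN_coset) (use assms lower_carrier coset_shift in auto)

subsection \<open>Homogeneous elements of the associated graded algebra\<close>

lemma gr_comp_simps:
  "carrier (gr_comp A m) = coset m ` piece A m"
  "one (gr_comp A m) = lower A m"
  by (auto simp: gr_comp_def FactGroup_def RCOSETS_def a_r_coset_def r_coset_def)

lemma gr_comp_group: "comm_group (gr_comp A m)"
proof -
  have p: "subgroup (piece A m) (add_monoid A)" by (rule piece_subgroup)
  have cg: "comm_group ((add_monoid A)\<lparr>carrier := piece A m\<rparr>)"
    by (rule group.group_comm_groupI[OF add.subgroup_imp_group[OF p]]) (simp add: a_comm piece_carrier)
  moreover have "subgroup (lower A m) ((add_monoid A)\<lparr>carrier := piece A m\<rparr>)"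
    using add.subgroup_incl[OF lower_subgroup p] lower_piece by blast
  ultimately show ?thesis unfolding gr_comp_def by (rule comm_group.abelian_FactGroup)
qed

lemma gr_comp_add:
  assumes "x \<in> piece A m" "y \<in> piece A m"
  shows "monoid.mult (gr_comp A m) (coset m x) (coset m y) = coset m (x \<oplus> y)"
proof -
  have n: "lower A m \<lhd> add_monoid A"
    by (rule comm_group.subgroup_imp_normal[OF add.comm_group_axioms lower_subgroup])
  have "monoid.mult (gr_comp A m) (coset m x) (coset m y) = set_mult (add_monoid A) (coset m x) (coset m y)"
    by (simp add: gr_comp_def FactGroup_def set_mult_def)
  also have "\<dots> = coset m (x \<oplus> y)"
    using normal.rcos_sum[OF n, of x y] assms piece_carrier by (simp add: a_r_coset_def)
  finally show ?thesis .
qed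

lemma lower_in_coset_image: "lower A m \<in> coset m ` piece A m"
  using coset_lower[OF lower_closed(2), of m] piece_closed(3)[of m] by (metis image_eqI)

text \<open>The symbol of \<open>x\<close> in degree \<open>m\<close>. All computations in
  \<open>gr A\<close> are done with such families concentrated in one degree.\<close>

definition inj :: "nat \<Rightarrow> 'a \<Rightarrow> nat \<Rightarrow> 'a set" where
  "inj m x = (\<lambda>n. if n = m then coset m x else lower A n)"

lemma carrier_gr:
  "carrier (gr A) = {f \<in> \<Pi>\<^sub>E i\<in>UNIV. coset i ` piece A i. finite {i. f i \<noteq> lower A i}}"
proof -
  have "\<And>i. i \<in> UNIV \<Longrightarrow> group (gr_comp A i)" using gr_comp_group comm_group.axioms(2) by blast
  from carrier_sum_group[of UNIV "gr_comp A", OF this] show ?thesis by (simp add: gr_def gr_comp_simps)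
qed

lemma inj_carrier:
  assumes "x \<in> piece A m"
  shows "inj m x \<in> carrier (gr A)"
proof -
  have "{i. inj m x i \<noteq> lower A i} \<subseteq> {m}" by (auto simp: inj_def)
  then have "finite {i. inj m x i \<noteq> lower A i}" by (rule finite_subset) simp
  moreover have "inj m x i \<in> coset i ` piece A i" for i
    using assms lower_closed(2)[of i] coset_lower[of \<zero> i] lower_piece[of \<zero> i]
    by (auto simp: inj_def intro!: image_eqI[of _ _ \<zero>])
  ultimately show ?thesis by (simp add: carrier_gr PiE_iff)
qed

lemma piece_gr: "piece (gr A) m = inj m ` piece A m"
proof -
  have "piece (gr A) m = {f \<in> carrier (gr A). \<forall>n. n \<noteq> m \<longrightarrow> f n = lower A n}" by (simp add: gr_def)
  also have "\<dots> = inj m ` piece A m"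
  proof (intro subset_antisym subsetI)
    fix f assume f: "f \<in> {f \<in> carrier (gr A). \<forall>n. n \<noteq> m \<longrightarrow> f n = lower A n}"
    then have "f m \<in> coset m ` piece A m" by (simp add: carrier_gr PiE_iff)
    then obtain x where x: "x \<in> piece A m" "f m = coset m x" by blast
    then have "f = inj m x" using f by (auto simp: inj_def fun_eq_iff)
    then show "f \<in> inj m ` piece A m" using x(1) by blast
  next
    fix f assume "f \<in> inj m ` piece A m"
    then obtain x where "x \<in> piece A m" "f = inj m x" by blast
    then show "f \<in> {f \<in> carrier (gr A). \<forall>n. n \<noteq> m \<longrightarrow> f n = lower A n}"
      using inj_carrier[of x m] by (simp add: inj_def)
  qed
  finally show ?thesis .
qed

lemma zero_gr: "ring.zero (gr A) = (\<lambda>n. lower A n)"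
  by (simp add: gr_def gr_comp_simps fun_eq_iff)

lemma inj_eq_zero_iff: "x \<in> piece A m \<Longrightarrow> inj m x = ring.zero (gr A) \<longleftrightarrow> x \<in> lower A m"
  using coset_eq_lower_iff[OF piece_carrier, of x m m] by (auto simp: zero_gr inj_def fun_eq_iff)

lemma inj_one: "one (gr A) = inj 0 \<one>"
  by (simp add: gr_def inj_def fun_eq_iff)

lemma inj_add:
  assumes "x \<in> piece A m" "y \<in> piece A m"
  shows "add (gr A) (inj m x) (inj m y) = inj m (x \<oplus> y)"
proof
  fix n
  have "monoid.mult (gr_comp A n) (lower A n) (lower A n) = lower A n"
    using gr_comp_add[of \<zero> n \<zero>] piece_closed(3) coset_lower[OF lower_closed(2)] by simp
  then show "add (gr A) (inj m x) (inj m y) n = inj m (x \<oplus> y) n"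
    using gr_comp_add[OF assms] by (simp add: gr_def inj_def)
qed

lemma inj_smult: "x \<in> piece A m \<Longrightarrow> module.smult (gr A) r (inj m x) = inj m (r \<odot> x)"
proof
  fix n assume x: "x \<in> piece A m"
  have *: "induced A (lower A n) (\<lambda>x. r \<odot> x) (coset n x) = coset n (r \<odot> x)" if "x \<in> carrier A" for n x
    using that smult lower_smult by (intro induced_coset) auto
  show "module.smult (gr A) r (inj m x) n = inj m (r \<odot> x) n"
    using *[of x m] *[of \<zero> n] coset_lower[OF lower_closed(2)] coset_lower[OF lower_smult[OF lower_closed(2)]] piece_carrier[OF x]
    by (simp add: gr_def inj_def)
qed

lemma inj_act: "x \<in> piece A m \<Longrightarrow> act (gr A) g (inj m x) = inj m (act A g x)"
proof
  fix n assume x: "x \<in> piece A m"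
  have *: "induced A (lower A n) (act A g) (coset n x) = coset n (act A g x)" if "x \<in> carrier A" for n x
    using that act_hom lower_act by (intro induced_coset) auto
  show "act (gr A) g (inj m x) n = inj m (act A g x) n"
    using *[of x m] *[of \<zero> n] coset_lower[OF lower_closed(2)] coset_lower[OF lower_act[OF lower_closed(2)]] piece_carrier[OF x]
    by (simp add: gr_def inj_def)
qed

lemma gr_times_coset:
  assumes "x \<in> piece A i" "y \<in> piece A j"
  shows "gr_times A i j (coset i x) (coset j y) = coset (i + j) (x \<otimes> y)"
  unfolding gr_times_def
proof (rule UN_coset)
  fix h assume h: "h \<in> lower A i"
  show "(\<Union>y\<in>coset j y. coset (i + j) ((h \<oplus> x) \<otimes> y)) = coset (i + j) (x \<otimes> y)"
  proof (rule UN_coset)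
    fix k assume k: "k \<in> lower A j"
    note c = lower_carrier[OF h] lower_carrier[OF k] piece_carrier[OF assms(1)] piece_carrier[OF assms(2)]
    have "(h \<oplus> x) \<otimes> (k \<oplus> y) = (h \<otimes> (k \<oplus> y) \<oplus> x \<otimes> k) \<oplus> x \<otimes> y"
      using c by (simp add: l_distr r_distr a_ac)
    moreover have "h \<otimes> (k \<oplus> y) \<oplus> x \<otimes> k \<in> lower A (i + j)"
      using lower_mult(1)[OF h piece_closed(1)[OF lower_piece[OF k] assms(2)]] lower_mult(2)[OF assms(1) k]
      by (rule lower_closed(1))
    ultimately show "coset (i + j) ((h \<oplus> x) \<otimes> (k \<oplus> y)) = coset (i + j) (x \<otimes> y)"
      using c by (simp add: coset_shift)
  qed (use assms piece_carrier in auto)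
qed (use assms piece_carrier in auto)

lemma inj_mult:
  assumes "x \<in> piece A i" "y \<in> piece A j"
  shows "monoid.mult (gr A) (inj i x) (inj j y) = inj (i + j) (x \<otimes> y)"
proof
  fix n
  interpret G: comm_group "gr_comp A n" by (rule gr_comp_group)
  \<comment> \<open>Both families are written as cosets of explicit representatives in every degree,
    so that \<open>gr_times_coset\<close> applies to each summand of the convolution; only the one
    with $l = i$ and $n = i + j$ can be nonzero.\<close>
  define U where "U l = (if l = i then x else \<zero>)" for l
  define V where "V l = (if l = j then y else \<zero>)" for l
  have inj: "inj i x l = coset l (U l)" "inj j y l = coset l (V l)" for l
    using coset_lower[OF lower_closed(2)] by (auto simp: inj_def U_def V_def)
  have UV: "U l \<in> piece A l" "V l \<in> piece A l" for l
    using assms piece_closed(3) by (auto simp: U_def V_def)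
  have t: "gr_times A l (n - l) (inj i x l) (inj j y (n - l)) = coset n (U l \<otimes> V (n - l))" if "l \<le> n" for l
    using gr_times_coset[OF UV(1)[of l] UV(2)[of "n - l"]] that by (simp add: inj)
  have UV_mult: "U l \<otimes> V (n - l) = (if l = i \<and> n = i + j then x \<otimes> y else \<zero>)" if "l \<le> n" for l
    using that assms piece_carrier by (auto simp: U_def V_def)
  have "monoid.mult (gr A) (inj i x) (inj j y) n = finprod (gr_comp A n) (\<lambda>l. coset n (U l \<otimes> V (n - l))) {..n}"
    unfolding gr_def monoid.simps
    by (rule G.finprod_cong) (use t piece_mult[OF UV] in \<open>auto simp: simp_implies_def gr_comp_simps\<close>, metis le_add_diff_inverse image_eqI)
  also have "\<dots> = inj (i + j) (x \<otimes> y) n"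
  proof (cases "n = i + j")
    case True
    have "finprod (gr_comp A n) (\<lambda>l. coset n (U l \<otimes> V (n - l))) {..n} =
      finprod (gr_comp A n) (\<lambda>l. if i = l then coset n (x \<otimes> y) else \<one>\<^bsub>gr_comp A n\<^esub>) {..n}"
      using True UV_mult coset_lower[OF lower_closed(2)] piece_mult[OF assms]
      by (intro G.finprod_cong) (auto simp: simp_implies_def gr_comp_simps lower_in_coset_image)
    also have "\<dots> = coset n (x \<otimes> y)"
      using True piece_mult[OF assms] by (intro G.finprod_singleton) (auto simp: gr_comp_simps)
    finally show ?thesis using True by (simp add: inj_def)
  next
    case False
    have "finprod (gr_comp A n) (\<lambda>l. coset n (U l \<otimes> V (n - l))) {..n} = \<one>\<^bsub>gr_comp A n\<^esub>"
      by (rule G.finprod_one_eqI) (use False UV_mult coset_lower[OF lower_closed(2)] in \<open>simp add: gr_comp_simps\<close>)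
    then show ?thesis using False by (simp add: inj_def gr_comp_simps)
  qed
  finally show "monoid.mult (gr A) (inj i x) (inj j y) n = inj (i + j) (x \<otimes> y) n" .
qed

end

section \<open>Presented algebras\<close>

lemma a_r_coset_free: "a_r_coset (ring_of_type_algebra :: 'k::field free ring) I f = {i + f | i. i \<in> I}"
  by (auto simp: a_r_coset_def' ring_of_type_algebra_def)

definition residue :: "'k::field free set \<Rightarrow> 'k free \<Rightarrow> 'k free set" where
  "residue I f = {h. h - f \<in> I}"

lemma coset_residue: "a_r_coset (ring_of_type_algebra :: 'k::field free ring) I f = residue I f"
  unfolding a_r_coset_free residue_def by (auto simp: algebra_simps) (metis diff_add_cancel)

context free_ideal
begin

lemma residue_eq_iff: "residue K f = residue K g \<longleftrightarrow> f - g \<in> K"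
proof
  assume eq: "residue K f = residue K g"
  have "f \<in> residue K f" by (simp add: residue_def)
  then show "f - g \<in> K" unfolding eq by (simp add: residue_def)
next
  assume fg: "f - g \<in> K"
  have "h - f \<in> K \<longleftrightarrow> h - g \<in> K" for h
    using add[OF _ fg, of "h - f"] diff[OF _ fg, of "h - g"] by auto
  then show "residue K f = residue K g" by (simp add: residue_def)
qed

lemma residue_0: "residue K 0 = K"
  by (simp add: residue_def)

lemma residue_UN:
  assumes "\<And>i. i \<in> K \<Longrightarrow> F (i + f) = C"
  shows "(\<Union>h\<in>residue K f. F h) = C"
proof -
  have "F h = C" if "h \<in> residue K f" for h
    using assms[of "h - f"] that by (simp add: residue_def)
  moreover have "f \<in> residue K f" by (simp add: residue_def)
  ultimately show ?thesis by auto
qed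

end

lemma presented_simps:
  fixes S :: "'k::field free set"
  defines "I \<equiv> ideal_span S"
  shows "carrier (presented S P) = range (residue I)"
    and "monoid.mult (presented S P) (residue I f) (residue I g) = residue I (f * g)"
    and "add (presented S P) (residue I f) (residue I g) = residue I (f + g)"
    and "one (presented S P) = residue I 1"
    and "ring.zero (presented S P) = residue I 0"
    and "module.smult (presented S P) r (residue I f) = residue I (const r * f)"
    and "act (presented S P) t C = (\<Union>h\<in>C. residue I (free_act t h))"
    and "piece (presented S P) m = residue I ` P m"
proof -
  let ?R = "ring_of_type_algebra :: 'k free ring"
  interpret R: ring ?R by (rule ring_free)
  have I: "genideal ?R S = I" by (simp add: I_def genideal_eq_ideal_span)
  interpret J: free_ideal I unfolding I_def by (rule free_ideal_span)
  have "ideal (genideal ?R S) ?R" by (rule R.genideal_ideal) (simp add: ring_of_type_algebra_def)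
  then interpret I: ideal I ?R by (simp add: I)
  show "carrier (presented S P) = range (residue I)"
  proof -
    have "carrier (presented S P) = a_rcosets\<^bsub>?R\<^esub> I"
      by (simp add: presented_def Let_def FactRing_def I)
    also have "\<dots> = (\<Union>f\<in>carrier ?R. {residue I f})"
      unfolding A_RCOSETS_def' coset_residue[symmetric] a_r_coset_def' ..
    also have "\<dots> = range (residue I)" by (auto simp: ring_of_type_algebra_def)
    finally show ?thesis .
  qed
  show "monoid.mult (presented S P) (residue I f) (residue I g) = residue I (f * g)"
    using I.rcoset_mult_add[of f g]
    by (simp add: presented_def Let_def FactRing_def I coset_residue) (simp add: ring_of_type_algebra_def)
  show "add (presented S P) (residue I f) (residue I g) = residue I (f + g)"
    using I.a_rcos_sum[of f g]
    by (simp add: presented_def Let_def FactRing_def I coset_residue) (simp add: ring_of_type_algebra_def)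
  show "one (presented S P) = residue I 1"
    by (simp add: presented_def Let_def FactRing_def I coset_residue) (simp add: ring_of_type_algebra_def)
  show "ring.zero (presented S P) = residue I 0"
    by (simp add: presented_def Let_def FactRing_def I J.residue_0)
  show "module.smult (presented S P) r (residue I f) = residue I (const r * f)"
    by (simp add: presented_def Let_def induced_def I coset_residue)
      (rule J.residue_UN, simp add: J.residue_eq_iff distrib_left J.mult_left)
  show "act (presented S P) t C = (\<Union>h\<in>C. residue I (free_act t h))"
    by (simp add: presented_def Let_def induced_def I coset_residue)
  show "piece (presented S P) m = residue I ` P m"
    by (simp add: presented_def Let_def I coset_residue)
qed

section \<open>Symbols and lifts of the generators\<close>

lemma B_alg_presented: "B_alg = presented B_rels homogeneous"
  by (simp add: B_alg_def B_rels_def Let_def)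

lemma T_alg_presented: "T_alg \<alpha>1 \<alpha>2 \<alpha>3 = presented (T_rels \<alpha>1 \<alpha>2 \<alpha>3) degree_le"
  by (simp add: T_alg_def T_rels_def Let_def)

section \<open>The group acting on the free algebra, and the relations of $G$ in conjugation
  form\<close>

lemma free_act_mult: "free_act (tgroup_mult s t) f = free_act s (free_act t (f :: 'k::field free))"
proof -
  have m: "gsign (tgroup_mult s t) = gsign s * gsign t" "gperm (tgroup_mult s t) x = gperm s (gperm t x)" for x
    by (transfer, simp add: power_add gword_perm_append)+
  have of_int: "subst \<sigma> (of_int n) = (of_int n :: 'k free)" for \<sigma> n
    using subst_const[of \<sigma> "of_int n"] by (simp add: const_def)
  have comm: "of_int k * (of_int n * g) = of_int n * (of_int k * g)" for k n and g :: "'k free"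
    by (metis mult.assoc mult_of_int_commute)
  show ?thesis
    by (simp add: free_act_def subst_subst subst_mult m mult.assoc of_int comm[of "gsign s" "gsign t"])
qed

lemma free_act_one: "free_act tgroup_one f = f"
proof -
  have "gsign tgroup_one = 1" "gperm tgroup_one = id" by (transfer, simp)+
  then show ?thesis by (simp add: free_act_def subst_gen_id)
qed

text \<open>The eight relations identify products in chains of three; read along these chains they
  say that \<open>gg x\<close> conjugates \<open>gg y\<close> to
  \<open>gg (letter_perm x y)\<close>.\<close>

lemma gg_braid: "tgroup_mult (gg (letter_perm x y)) (gg x) = tgroup_mult (gg x) (gg y)"
proof -
  have r: "tgroup_mult (gg x) (gg y) = tgroup_mult (gg z) (gg w)"
    if "([(x, True), (y, True)], [(z, True), (w, True)]) \<in> group_rels" for x y z w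
    using that by transfer (simp add: gword_eq.rel)
  have
    "tgroup_mult (gg La) (gg Lb) = tgroup_mult (gg Lb) (gg Lc)" "tgroup_mult (gg Lb) (gg Lc) = tgroup_mult (gg Lc) (gg La)"
    "tgroup_mult (gg La) (gg Lc) = tgroup_mult (gg Lc) (gg Ld)" "tgroup_mult (gg Lc) (gg Ld) = tgroup_mult (gg Ld) (gg La)"
    "tgroup_mult (gg La) (gg Ld) = tgroup_mult (gg Ld) (gg Lb)" "tgroup_mult (gg Ld) (gg Lb) = tgroup_mult (gg Lb) (gg La)"
    "tgroup_mult (gg Lb) (gg Ld) = tgroup_mult (gg Ld) (gg Lc)" "tgroup_mult (gg Ld) (gg Lc) = tgroup_mult (gg Lc) (gg Lb)"
    by (rule r; simp add: group_rels_def)+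
  then show ?thesis by (cases x; cases y) simp_all
qed

text \<open>Inverse generators enter as an element \<open>s\<close> with its two cancellation
  equations, so applications need no words.\<close>

lemma tgroup_induct [case_names one gen inverse]:
  assumes "P tgroup_one" and gen: "\<And>x t. P t \<Longrightarrow> P (tgroup_mult (gg x) t)"
    and inv: "\<And>x s t. tgroup_mult (gg x) s = tgroup_one \<Longrightarrow> tgroup_mult s (gg x) = tgroup_one \<Longrightarrow> P t \<Longrightarrow> P (tgroup_mult s t)"
  shows "P t"
proof -
  have "P (abs_tgroup w)" for w
  proof (induction w)
    case Nil
    then show ?case using assms(1) by (simp add: tgroup_one_def)
  next
    case (Cons p w)
    obtain x s where p: "p = (x, s)" by fastforce
    have w: "abs_tgroup (p # w) = tgroup_mult (abs_tgroup [(x, s)]) (abs_tgroup w)"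
      by (simp add: tgroup_mult.abs_eq p)
    show ?case
    proof (cases s)
      case True
      then show ?thesis using gen[OF Cons, of x] w by (simp add: gg_def)
    next
      case False
      have "tgroup_mult (gg x) (abs_tgroup [(x, False)]) = tgroup_one"
        "tgroup_mult (abs_tgroup [(x, False)]) (gg x) = tgroup_one"
        using gword_eq.cancel[of x True] gword_eq.cancel[of x False]
        by (simp_all add: gg_def tgroup_one_def tgroup_mult.abs_eq tgroup.abs_eq_iff)
      from inv[OF this Cons] show ?thesis using w False by simp
    qed
  qed
  then show ?thesis by (metis tgroup.abs_induct)
qed

context filtered_algebra
begin

lemma zero_smult: "x \<in> carrier A \<Longrightarrow> 0 \<odot> x = \<zero>"
  using smult(2)[of x 0 0] smult(1)[of x 0] by (simp add: add.l_cancel_one')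

lemma minus_smult: "x \<in> carrier A \<Longrightarrow> (- 1) \<odot> x = \<ominus> x"
  using smult(2)[of x "- 1" 1] smult(1)[of x "- 1"] smult(5)[of x] zero_smult[of x]
  by (intro minus_equality[symmetric]) simp_all

lemma act_minus: "x \<in> carrier A \<Longrightarrow> act A t (\<ominus> x) = \<ominus> act A t x"
  using act_smult[of x t "- 1"] act_hom(1)[of x t] by (simp add: minus_smult)

end

locale symbol = filtered_algebra A for A :: "('k::field, 'a) galgebra" (structure) +
  fixes \<psi> :: "(nat \<Rightarrow> 'a set) \<Rightarrow> 'k free set"
  assumes psi_iso: "\<psi> \<in> ring_iso (gr A) B_alg"
    and psi_smult: "f \<in> carrier (gr A) \<Longrightarrow> \<psi> (module.smult (gr A) r f) = module.smult B_alg r (\<psi> f)"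
    and psi_act: "f \<in> carrier (gr A) \<Longrightarrow> \<psi> (act (gr A) t f) = act B_alg t (\<psi> f)"
    and psi_piece: "\<psi> ` piece (gr A) m = piece B_alg m"
    and two: "(2 :: 'k) \<noteq> 0" and three: "(3 :: 'k) \<noteq> 0"
begin

abbreviation I :: "'k free set" where "I \<equiv> ideal_span B_rels"

sublocale I: free_ideal I by (rule free_ideal_span)

text \<open>The class in $B$ of the degree \<open>m\<close> symbol. It depends on \<open>m\<close>
  and not only on \<open>x\<close>: it is zero as soon as \<open>x\<close> lies in the lower
  filtration piece.\<close>

definition sym :: "nat \<Rightarrow> 'a \<Rightarrow> 'k free set" where
  "sym m x = \<psi> (inj m x)"

lemma sym_exists:
  assumes "x \<in> piece A m"
  obtains f where "f \<in> homogeneous m" "sym m x = residue I f"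
proof -
  have "sym m x \<in> piece B_alg m" using psi_piece[of m] assms by (auto simp: sym_def piece_gr)
  then show thesis using that by (auto simp: B_alg_presented presented_simps)
qed

lemma sym_surj:
  assumes "f \<in> homogeneous m"
  obtains x where "x \<in> piece A m" "sym m x = residue I f"
proof -
  have "residue I f \<in> \<psi> ` piece (gr A) m"
    using assms by (auto simp: psi_piece B_alg_presented presented_simps)
  then show thesis using that by (auto simp: piece_gr sym_def)
qed

lemma sym_add:
  assumes "x \<in> piece A m" "y \<in> piece A m" "sym m x = residue I f" "sym m y = residue I g"
  shows "sym m (x \<oplus> y) = residue I (f + g)"
proof -
  have "\<psi> \<in> ring_hom (gr A) B_alg" using psi_iso by (simp add: ring_iso_def)
  then have "\<psi> (add (gr A) (inj m x) (inj m y)) = add B_alg (\<psi> (inj m x)) (\<psi> (inj m y))"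
    using inj_carrier assms(1,2) by (simp add: ring_hom_def)
  then show ?thesis using assms by (simp add: sym_def inj_add B_alg_presented presented_simps)
qed

lemma sym_mult:
  assumes "x \<in> piece A m" "y \<in> piece A n" "sym m x = residue I f" "sym n y = residue I g"
  shows "sym (m + n) (x \<otimes> y) = residue I (f * g)"
proof -
  have "\<psi> \<in> ring_hom (gr A) B_alg" using psi_iso by (simp add: ring_iso_def)
  then have "\<psi> (monoid.mult (gr A) (inj m x) (inj n y)) = monoid.mult B_alg (\<psi> (inj m x)) (\<psi> (inj n y))"
    using inj_carrier assms(1,2) by (simp add: ring_hom_def)
  then show ?thesis using assms by (simp add: sym_def inj_mult B_alg_presented presented_simps)
qed

lemma sym_one: "sym 0 \<one> = residue I 1"
proof -
  have "\<psi> \<in> ring_hom (gr A) B_alg" using psi_iso by (simp add: ring_iso_def)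
  then have "\<psi> (one (gr A)) = one B_alg" by (simp add: ring_hom_def)
  then show ?thesis by (simp add: sym_def inj_one B_alg_presented presented_simps)
qed

lemma sym_smult:
  assumes "x \<in> piece A m" "sym m x = residue I f"
  shows "sym m (r \<odot> x) = residue I (const r * f)"
  using psi_smult[OF inj_carrier[OF assms(1)], of r] assms
  by (simp add: sym_def inj_smult B_alg_presented presented_simps)

text \<open>
  That the action on \<open>B_alg\<close> is induced by \<^const>\<open>free_act\<close> needs no proof that the ideal is stable:
  the values of the action are known to be single residue classes because \<open>\<psi>\<close> is equivariant.
\<close>

lemma sym_act:
  assumes "x \<in> piece A m" "sym m x = residue I f"
  shows "sym m (act A t x) = residue I (free_act t f)"
proof -
  obtain h where h: "sym m (act A t x) = residue I h" using sym_exists[OF piece_act[OF assms(1)]] by metis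
  have "f \<in> residue I f" by (simp add: residue_def)
  then have "residue I (free_act t f) \<subseteq> sym m (act A t x)"
    using psi_act[OF inj_carrier[OF assms(1)], of t] assms
    by (auto simp: sym_def inj_act B_alg_presented presented_simps)
  moreover have "free_act t f \<in> residue I (free_act t f)" by (simp add: residue_def)
  ultimately have "free_act t f \<in> residue I h" using h by blast
  then have "free_act t f - h \<in> I" by (simp add: residue_def)
  then show ?thesis using h I.residue_eq_iff by metis
qed

lemma sym_minus:
  assumes "x \<in> piece A m" "sym m x = residue I f"
  shows "sym m (\<ominus> x) = residue I (- f)"
  using sym_smult[OF assms, of "- 1"] assms piece_carrier by (simp add: minus_smult const_minus)

lemma sym_eq_0_iff:
  assumes "x \<in> piece A m"
  shows "sym m x = residue I 0 \<longleftrightarrow> x \<in> lower A m"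
proof -
  have z: "sym m \<zero> = residue I 0"
  proof -
    obtain f where f: "sym m \<zero> = residue I f" using sym_exists[OF piece_closed(3)] by metis
    have "residue I f = residue I (f + f)"
      using sym_add[OF piece_closed(3) piece_closed(3) f f] f by simp
    then have "f - (f + f) \<in> I" by (simp only: I.residue_eq_iff)
    then have "- (f - (f + f)) \<in> I" by (rule I.minus)
    then show ?thesis using f I.residue_eq_iff[of f 0] by simp
  qed
  have "inj_on \<psi> (carrier (gr A))" using psi_iso by (simp add: ring_iso_def bij_betw_def)
  then have "sym m x = sym m \<zero> \<longleftrightarrow> inj m x = inj m \<zero>"
    using inj_carrier[OF assms] inj_carrier[OF piece_closed(3)] by (auto simp: sym_def dest: inj_onD)
  moreover have "inj m \<zero> = ring.zero (gr A)"
    using inj_eq_zero_iff[OF piece_closed(3)] lower_closed(2) by blast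
  ultimately show ?thesis using z inj_eq_zero_iff[OF assms] by simp
qed

lemma sym_eq_iff:
  assumes "x \<in> piece A m" "y \<in> piece A m"
  shows "sym m x = sym m y \<longleftrightarrow> x \<ominus> y \<in> lower A m"
proof -
  obtain f where f: "sym m x = residue I f" using sym_exists[OF assms(1)] by metis
  obtain g where g: "sym m y = residue I g" using sym_exists[OF assms(2)] by metis
  have "sym m (x \<ominus> y) = residue I (f - g)"
    using sym_add[OF assms(1) piece_closed(4)[OF assms(2)] f sym_minus[OF assms(2) g]] by (simp add: a_minus_def)
  then have "x \<ominus> y \<in> lower A m \<longleftrightarrow> f - g \<in> I"
    using sym_eq_0_iff[OF piece_closed(2)[OF assms]] I.residue_eq_iff[of "f - g" 0] by simp
  then show ?thesis using f g I.residue_eq_iff by simp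
qed

text \<open>Degree 0 of $B$ consists of constants, and \<open>lower A 0\<close> is zero, so the
  symbol in degree 0 determines the element.\<close>

lemma piece_0_scalar:
  assumes "x \<in> piece A 0"
  obtains r where "x = r \<odot> \<one>"
proof -
  obtain f where f: "f \<in> homogeneous 0" "sym 0 x = residue I f" using sym_exists[OF assms] by metis
  have "f = const (Poly_Mapping.lookup f 0)"
  proof (rule poly_mapping_eqI)
    fix w
    have "letters w = []" if "w \<in> Poly_Mapping.keys f" using f(1) that by (simp add: homogeneous_def)
    then have "w = 0 \<or> Poly_Mapping.lookup f w = 0"
      by (cases w) (auto simp: zero_word_def in_keys_iff)
    then show "Poly_Mapping.lookup f w = Poly_Mapping.lookup (const (Poly_Mapping.lookup f 0)) w"
      by (auto simp: const_def lookup_single when_def)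
  qed
  then obtain r where r: "f = const r" by blast
  have "sym 0 (r \<odot> \<one>) = residue I (const r * 1)" by (rule sym_smult[OF piece_one sym_one])
  then have "x \<ominus> r \<odot> \<one> \<in> lower A 0"
    using sym_eq_iff[OF assms piece_smult[OF piece_one, of r]] f(2) r by simp
  then have "x \<ominus> r \<odot> \<one> = \<zero>" by (simp add: lower_def)
  then have "x = r \<odot> \<one>" using piece_carrier[OF assms] smult(1)[OF one_closed] by simp
  then show thesis by (rule that)
qed

lemma lower_1: "lower A 1 = piece A 0"
  by (simp add: lower_def)

lemma act_scalar: "act A t (r \<odot> \<one>) = r \<odot> \<one>"
  using act_smult[OF one_closed] act_hom(4) by simp

lemma eq_minus_scalar_zero:
  assumes "r \<odot> \<one> = \<ominus> (r \<odot> \<one>)"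
  shows "r \<odot> \<one> = \<zero>"
proof -
  have c: "r \<odot> \<one> \<in> carrier A" using smult(1) by simp
  have "(r + r) \<odot> \<one> = \<zero>" using assms c smult(2)[of \<one> r r] by (metis one_closed r_neg)
  then have "(1 / 2) \<odot> ((r + r) \<odot> \<one>) = (0 :: 'k) \<odot> (r \<odot> \<one>)"
    using smult(4)[of "\<one>" "1 / 2" 0] zero_smult c by (metis mult_zero_right one_closed)
  moreover have "(1 / 2) * (r + r) = r" using two by (simp add: field_simps flip: mult_2)
  ultimately show ?thesis using smult(4)[of \<one> "1 / 2" "r + r"] zero_smult c by simp
qed

text \<open>
  The generator \<open>gg y\<close> negates the class of the letter \<open>y\<close>; as 2 is invertible, a unique lift of this
  class is negated as well, and by uniqueness these lifts span a submodule.
\<close>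

lemma exists_lift: "\<exists>x. x \<in> piece A 1 \<and> sym 1 x = residue I (gen y) \<and> act A (gg y) x = \<ominus> x"
proof -
  obtain x where x: "x \<in> piece A 1" "sym 1 x = residue I (gen y)" using sym_surj[OF gen_degree] by metis
  have s: "sym 1 (act A (gg y) x) = residue I (- gen y)"
    using sym_act[OF x, of "gg y"] by (simp add: free_act_gg) (cases y; simp)
  have "sym 1 (act A (gg y) x \<oplus> x) = residue I 0"
    using sym_add[OF piece_act[OF x(1)] x(1) s x(2)] by simp
  then have "act A (gg y) x \<oplus> x \<in> piece A 0"
    using sym_eq_0_iff[OF piece_closed(1)[OF piece_act[OF x(1)] x(1)]] lower_1 by simp
  then obtain r where r: "act A (gg y) x \<oplus> x = r \<odot> \<one>" by (rule piece_0_scalar)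
  \<comment> \<open>The group fixes scalars: if the generator sends \<open>x\<close> to $r - x$, it
    sends $x - r/2$ to its negative.\<close>
  define e where "e = (r / 2) \<odot> \<one>"
  have e0: "e \<in> lower A 1" unfolding e_def lower_1 by (rule piece_smult[OF piece_one])
  note c = piece_carrier[OF x(1)] lower_carrier[OF e0] act_hom(1)[OF piece_carrier[OF x(1)], of "gg y"]
  have ee: "e \<oplus> e = r \<odot> \<one>" using smult(2)[of \<one> "r / 2" "r / 2"] two by (simp add: e_def)
  let ?x = "x \<ominus> e"
  have p: "?x \<in> piece A 1" by (rule piece_closed(2)[OF x(1) lower_piece[OF e0]])
  have "\<ominus> e \<in> lower A 1" by (rule lower_closed(3)[OF e0])
  moreover have "?x \<ominus> x = \<ominus> e"
  proof -
    have "?x \<ominus> x = (\<ominus> e \<oplus> x) \<oplus> \<ominus> x" using c by (simp add: a_minus_def a_comm)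
    then show ?thesis using c by (simp add: a_assoc r_neg)
  qed
  ultimately have "sym 1 ?x = residue I (gen y)" using sym_eq_iff[OF p x(1)] x(2) by simp
  moreover have "act A (gg y) ?x = \<ominus> ?x"
  proof -
    have "act A (gg y) x = (e \<oplus> e) \<ominus> x"
      using r ee c by (metis a_minus_def add.inv_solve_right' add.m_closed)
    moreover have "act A (gg y) e = e" by (simp add: e_def act_scalar)
    ultimately have "act A (gg y) ?x = (e \<oplus> e \<ominus> x) \<ominus> e"
      using c by (simp add: a_minus_def act_hom act_minus)
    also have "\<dots> = (\<ominus> x \<oplus> e) \<oplus> (e \<oplus> \<ominus> e)" using c by (simp add: a_minus_def a_ac)
    also have "\<dots> = \<ominus> ?x" using c by (simp add: a_minus_def minus_add r_neg)
    finally show ?thesis .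
  qed
  ultimately show ?thesis using p by blast
qed

text \<open>The difference of two lifts is a scalar, hence fixed by the group, but it is also
  negated by \<open>t\<close>; as 2 is invertible it vanishes.\<close>

lemma lift_unique:
  assumes "x \<in> piece A 1" "y \<in> piece A 1" "sym 1 x = sym 1 y"
    and "act A t x = \<ominus> x" "act A t y = \<ominus> y"
  shows "x = y"
proof -
  have "x \<ominus> y \<in> piece A 0" using sym_eq_iff[OF assms(1,2)] assms(3) lower_1 by simp
  then obtain r where r: "x \<ominus> y = r \<odot> \<one>" by (rule piece_0_scalar)
  note c = piece_carrier[OF assms(1)] piece_carrier[OF assms(2)]
  have "r \<odot> \<one> = act A t (x \<ominus> y)" using r act_scalar by simp
  also have "\<dots> = \<ominus> x \<ominus> \<ominus> y" using c assms(4,5) by (simp add: a_minus_def act_hom act_minus)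
  also have "\<dots> = \<ominus> (x \<ominus> y)" using c by (simp add: a_minus_def minus_add)
  finally have "r \<odot> \<one> = \<zero>" using r eq_minus_scalar_zero by simp
  then show ?thesis using r c by simp
qed

definition lift :: "letter \<Rightarrow> 'a" where
  "lift y = (SOME x. x \<in> piece A 1 \<and> sym 1 x = residue I (gen y) \<and> act A (gg y) x = \<ominus> x)"

lemma lift: "lift y \<in> piece A 1" "sym 1 (lift y) = residue I (gen y)" "act A (gg y) (lift y) = \<ominus> lift y"
  using someI_ex[OF exists_lift[of y]] by (simp_all add: lift_def)

lemma lift_carrier [simp]: "lift y \<in> carrier A"
  using lift(1) by (rule piece_carrier)

text \<open>By \<open>gg_braid\<close>, applying \<open>gg (letter_perm x y)\<close> after
  \<open>gg x\<close> is the same as applying \<open>gg x\<close> after \<open>gg y\<close>. So the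
  image of \<open>lift y\<close> is negated by the generator of the letter
  \<open>letter_perm x y\<close>, and uniqueness of lifts identifies it up to sign.\<close>

lemma act_lift: "act A (gg x) (lift y) = \<ominus> lift (letter_perm x y)"
proof -
  let ?z = "letter_perm x y" and ?u = "act A (gg x) (lift y)"
  have u: "?u \<in> piece A 1" by (rule piece_act[OF lift(1)])
  have c: "?u \<in> carrier A" using u by (rule piece_carrier)
  have "sym 1 ?u = residue I (- gen ?z)" using sym_act[OF lift(1,2), of "gg x"] by (simp add: free_act_gg)
  from sym_minus[OF u this] have s: "sym 1 (\<ominus> ?u) = sym 1 (lift ?z)"
    by (simp add: lift(2)[unfolded One_nat_def])
  have "act A (gg ?z) ?u = act A (tgroup_mult (gg ?z) (gg x)) (lift y)" by (simp add: act_mult)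
  also have "\<dots> = act A (gg x) (act A (gg y) (lift y))" by (simp add: gg_braid act_mult)
  also have "\<dots> = \<ominus> ?u" by (simp add: lift(3) act_minus)
  finally have "act A (gg ?z) (\<ominus> ?u) = \<ominus> (\<ominus> ?u)" using c by (simp add: act_minus)
  then have "\<ominus> ?u = lift ?z"
    by (rule lift_unique[OF piece_closed(4)[OF u] lift(1) s _ lift(3)])
  then show ?thesis using c by (metis minus_minus)
qed

subsection \<open>Evaluation at the lifts\<close>

primrec monomial :: "letter list \<Rightarrow> 'a" where
  "monomial [] = \<one>"
| "monomial (x # l) = lift x \<otimes> monomial l"

lemma monomial_carrier [simp]: "monomial l \<in> carrier A"
  by (induction l) simp_all

lemma monomial_append: "monomial (l @ l') = monomial l \<otimes> monomial l'"
  by (induction l) (simp_all add: m_assoc)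

definition ev :: "'k free \<Rightarrow> 'a" where
  "ev f = (\<Oplus>w\<in>Poly_Mapping.keys f. Poly_Mapping.lookup f w \<odot> monomial (letters w))"

lemma ev_superset:
  assumes "finite W" "Poly_Mapping.keys f \<subseteq> W"
  shows "ev f = (\<Oplus>w\<in>W. Poly_Mapping.lookup f w \<odot> monomial (letters w))"
  unfolding ev_def
  by (rule add.finprod_mono_neutral_cong_left)
     (use assms smult(1) zero_smult in \<open>auto simp: in_keys_iff\<close>)

lemma ev_add: "ev (f + g) = ev f \<oplus> ev g"
proof -
  define W where "W = Poly_Mapping.keys f \<union> Poly_Mapping.keys g"
  have W: "finite W" "Poly_Mapping.keys f \<subseteq> W" "Poly_Mapping.keys g \<subseteq> W" "Poly_Mapping.keys (f + g) \<subseteq> W"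
    using keys_add[of f g] by (simp_all add: W_def)
  show ?thesis
    unfolding W(2-4)[THEN ev_superset[OF W(1)]]
    by (subst finsum_addf[symmetric]) (auto simp: lookup_add smult intro!: finsum_cong')
qed

lemma ev_single: "ev (Poly_Mapping.single w r) = r \<odot> monomial (letters w)"
  by (subst ev_superset[of "{w}"]) (auto simp: smult)

lemma ev_carrier [simp]: "ev f \<in> carrier A"
  by (induction f rule: free_induct) (simp_all add: ev_single ev_add smult)

lemma ev_mult: "ev (f * g) = ev f \<otimes> ev g"
proof (induction f rule: free_induct)
  case (single u r)
  show ?case
  proof (induction g rule: free_induct)
    case (single v s)
    have "s \<odot> (r \<odot> x) = r \<odot> (s \<odot> x)" if "x \<in> carrier A" for x
      by (metis mult.commute smult(4) that)
    then show ?case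
      by (simp add: mult_single ev_single monomial_append smult smult_mult_left smult_mult_right)
  qed (simp add: distrib_left ev_add r_distr)
qed (simp add: distrib_right ev_add l_distr)

lemma ev_1: "ev 1 = \<one>"
  using ev_single[of 0 1] by (simp add: smult)

lemma ev_const_mult: "ev (const r * f) = r \<odot> ev f"
  by (simp add: ev_mult const_def ev_single smult_mult_left)

lemma ev_0: "ev 0 = \<zero>"
  using ev_const_mult[of 0 0] by (simp add: zero_smult)

lemma ev_minus: "ev (- f) = \<ominus> ev f"
  using ev_const_mult[of "- 1" f] by (simp add: const_minus minus_smult)

lemma ev_diff: "ev (f - g) = ev f \<ominus> ev g"
  using ev_add[of f "- g"] by (simp add: ev_minus a_minus_def)

lemma ev_gen: "ev (gen x) = lift x"
  by (simp add: gen_def ev_single smult)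

lemma ev_subst:
  assumes "\<And>x. ev (\<tau> x) = act A t (lift x)"
  shows "ev (subst \<tau> f) = act A t (ev f)"
proof (induction f rule: free_induct)
  case (single w r)
  have "ev (prod_list (map \<tau> l)) = act A t (monomial l)" for l
    by (induction l) (simp_all add: ev_1 ev_mult act_hom assms)
  then show ?case by (simp add: subst_single ev_const_mult ev_single act_smult)
qed (simp add: subst_add ev_add act_hom)

lemma ev_free_act_gg: "ev (free_act (gg x) f) = act A (gg x) (ev f)"
  unfolding free_act_gg by (rule ev_subst) (simp add: ev_minus ev_gen act_lift)

lemma ev_free_act: "ev (free_act t f) = act A t (ev f)"
proof (induction t arbitrary: f rule: tgroup_induct)
  case one
  show ?case by (simp add: free_act_one act_one)
next
  case (gen x t)
  then show ?case by (simp add: free_act_mult act_mult ev_free_act_gg)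
next
  case (inverse x s t)
  have "ev (free_act s g) = act A s (ev g)" for g
  proof -
    \<comment> \<open>Equivariance under an inverse generator follows from that under the generator:
      both sides agree after \<open>gg x\<close>, which is then undone by \<open>s\<close>.\<close>
    have "act A (gg x) (ev (free_act s g)) = ev g"
      using ev_free_act_gg[of x "free_act s g"] inverse(1) by (simp add: free_act_one flip: free_act_mult)
    then have "act A s (ev g) = act A (tgroup_mult s (gg x)) (ev (free_act s g))" by (simp add: act_mult)
    then show ?thesis using inverse(2) by (simp add: act_one)
  qed
  then show ?case using inverse(3) by (simp add: free_act_mult act_mult)
qed

lemma sym_monomial: "monomial l \<in> piece A (length l) \<and> sym (length l) (monomial l) = residue I (wd l)"
proof (induction l)
  case Nil
  show ?case using piece_one sym_one by (simp add: wd_Nil)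
next
  case (Cons x l)
  then show ?case
    using piece_mult[OF lift(1), of "monomial l" "length l" x] sym_mult[OF lift(1) _ lift(2), of "monomial l" "length l"]
    by (simp add: wd_Cons)
qed

text \<open>On homogeneous elements, evaluation followed by the symbol is the projection onto $B$;
  this holds for letters by the choice of the lifts and extends multiplicatively.\<close>

lemma sym_ev:
  assumes "f \<in> homogeneous m"
  shows "ev f \<in> piece A m \<and> sym m (ev f) = residue I f"
  using assms
proof (induction rule: homogeneous_induct)
  case (single w r)
  then show ?case
    using sym_monomial[of "letters w"] piece_smult sym_smult[of "monomial (letters w)" m "wd (letters w)" r]
    by (auto simp: ev_single const_mult_single)
next
  case (add f g)
  then show ?case using piece_closed(1) sym_add by (simp add: ev_add)
qed (use sym_eq_0_iff[OF piece_closed(3)] lower_closed(2) piece_closed(3) in \<open>simp add: ev_0\<close>)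

lemma ev_degree_le: "f \<in> degree_le m \<Longrightarrow> ev f \<in> piece A m"
proof -
  assume f: "f \<in> degree_le m"
  have "ev (restrict_words (\<lambda>w. length (letters w) \<le> m) g) \<in> piece A m" for g
  proof (induction g rule: free_induct)
    case (single w r)
    then show ?case
      using sym_monomial[of "letters w"] piece_mono[of "length (letters w)" m] piece_smult piece_closed(3)
      by (auto simp: restrict_words_single ev_0 ev_single)
  qed (simp add: restrict_words_add ev_add piece_closed(1))
  moreover have "restrict_words (\<lambda>w. length (letters w) \<le> m) f = f"
    using f by (intro poly_mapping_eqI) (auto simp: restrict_words.rep_eq degree_le_def in_keys_iff)
  ultimately show ?thesis by metis
qed

text \<open>Subtracting the evaluation of a representative of the symbol moves \<open>x\<close> into
  the lower piece, where the induction hypothesis applies.\<close>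

lemma piece_eq_ev: "piece A m = ev ` degree_le m"
proof (intro subset_antisym subsetI)
  fix x assume "x \<in> piece A m"
  then show "x \<in> ev ` degree_le m"
  proof (induction m arbitrary: x rule: less_induct)
    case (less m)
    obtain f where f: "f \<in> homogeneous m" "sym m x = residue I f" using sym_exists[OF less.prems] by metis
    have e: "ev f \<in> piece A m" "sym m (ev f) = residue I f" using sym_ev[OF f(1)] by auto
    have low: "x \<ominus> ev f \<in> lower A m" using sym_eq_iff[OF less.prems e(1)] f(2) e(2) by simp
    obtain h where h: "h \<in> degree_le m" "x \<ominus> ev f = ev h"
    proof (cases m)
      case 0
      then show ?thesis using low that[of 0] by (simp add: lower_def ev_0)
    next
      case (Suc n)
      then have "x \<ominus> ev f \<in> ev ` degree_le n" using low less.IH[of n] by (simp add: lower_def)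
      then obtain h where "h \<in> degree_le n" "x \<ominus> ev f = ev h" by blast
      moreover have "h \<in> degree_le m" using \<open>h \<in> degree_le n\<close> Suc by (auto simp: degree_le_def)
      ultimately show ?thesis using that by blast
    qed
    have "x = (x \<ominus> ev f) \<oplus> ev f" using piece_carrier[OF less.prems] by (simp add: a_minus_def a_assoc l_neg)
    then have "x = ev (h + f)" using h(2) by (simp add: ev_add)
    moreover have "h + f \<in> degree_le m" by (intro degree_add_closed h homogeneous_degree_le f)
    ultimately show ?case by blast
  qed
qed (use ev_degree_le in blast)

lemma lower_eq_ev: "lower A m = ev ` degree_less m"
  by (cases m) (simp_all add: lower_def ev_0 piece_eq_ev degree_less_Suc)

section \<open>The kernel of evaluation\<close>

definition relations :: "'k free set" where
  "relations = {f. ev f = \<zero>}"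

lemma free_ideal_relations: "free_ideal relations"
  by standard (auto simp: relations_def ev_0 ev_add ev_mult)

lemma residue_relations: "residue relations f = {h. ev h = ev f}"
  by (auto simp: residue_def relations_def ev_diff)

lemma free_act_relations: "f \<in> relations \<Longrightarrow> free_act t f \<in> relations"
  using act_smult[OF zero_closed, of t 0] act_hom(1)[OF zero_closed, of t]
  by (simp add: relations_def ev_free_act zero_smult)

text \<open>The sign comes from the cube of \<open>gg La\<close>: \<open>letter_perm La\<close> has
  order 3 and - 1 is raised to an odd power. For \<open>leading\<close>, \<open>f\<close> is in the
  ideal of $B$ exactly when the symbol of \<open>ev f\<close> vanishes, that is, when
  \<open>ev f\<close> is also the value of an element of smaller degree.\<close>

lemma deformation_ideal_relations: "deformation_ideal relations"
proof -
  interpret free_ideal relations by (rule free_ideal_relations)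
  have n: "negate f \<in> relations" if "f \<in> relations" for f
  proof -
    have p: "letter_perm La (letter_perm La (letter_perm La x)) = x" for x by (cases x) simp_all
    have "negate f = free_act (gg La) (free_act (gg La) (free_act (gg La) f))"
      by (simp add: free_act_gg subst_subst subst_minus p)
    then show ?thesis using that free_act_relations by simp
  qed
  show ?thesis
  proof
    fix f y assume "f \<in> relations"
    from n[OF free_act_relations[OF this, of "gg y"]] show "relabel (letter_perm y) f \<in> relations"
      by (simp add: free_act_gg subst_subst subst_minus)
  next
    fix f :: "'k free" and m assume f: "f \<in> homogeneous m"
    have "f \<in> I \<longleftrightarrow> sym m (ev f) = residue I 0"
      using sym_ev[OF f] I.residue_eq_iff[of f 0] by simp
    also have "\<dots> \<longleftrightarrow> ev f \<in> ev ` degree_less m"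
      using sym_eq_0_iff[of "ev f" m] sym_ev[OF f] lower_eq_ev[of m] by simp
    also have "\<dots> \<longleftrightarrow> (\<exists>h\<in>degree_less m. f + h \<in> relations)"
    proof
      assume "ev f \<in> ev ` degree_less m"
      then obtain h where "h \<in> degree_less m" "ev f = ev h" by blast
      then show "\<exists>h\<in>degree_less m. f + h \<in> relations"
        by (intro bexI[of _ "- h"]) (simp_all add: relations_def ev_diff a_minus_def r_neg degree_minus_closed)
    next
      assume "\<exists>h\<in>degree_less m. f + h \<in> relations"
      then obtain h where h: "h \<in> degree_less m" "ev f \<oplus> ev h = \<zero>" by (auto simp: relations_def ev_add)
      then have "ev f = ev (- h)" by (simp add: ev_minus) (metis ev_carrier minus_equality minus_minus)
      then show "ev f \<in> ev ` degree_less m" using degree_minus_closed[OF h(1)] by blast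
    qed
    finally show "f \<in> I \<longleftrightarrow> (\<exists>h\<in>degree_less m. f + h \<in> relations)" .
  qed (fact n two three)+
qed

theorem iso_T_alg: "\<exists>\<alpha> \<beta> \<gamma>. galgebra_iso A (T_alg \<alpha> \<beta> \<gamma>)"
proof -
  obtain \<alpha> \<beta> \<gamma> where K: "relations = ideal_span (T_rels \<alpha> \<beta> \<gamma>)"
    using deformation_ideal.eq_T_ideal[OF deformation_ideal_relations] by blast
  let ?T = "T_alg \<alpha> \<beta> \<gamma>"
  interpret K: free_ideal relations by (rule free_ideal_relations)
  note T = presented_simps[of "T_rels \<alpha> \<beta> \<gamma>" degree_le, folded K T_alg_presented]
  \<comment> \<open>The fibre of \<open>ev\<close> over \<open>x\<close> is a residue class modulo
    \<open>relations\<close>; so this is the inverse of the isomorphism induced by \<open>ev\<close>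
    on the quotient.\<close>
  define \<phi> where "\<phi> x = {f. ev f = x}" for x
  have phi: "\<phi> (ev f) = residue relations f" for f by (simp add: \<phi>_def residue_relations)
  have surj: "carrier A = range ev"
    using piece_exhaustive piece_eq_ev exists_degree_le ev_carrier by (auto 4 4)
  have elim: thesis if "x \<in> carrier A" "\<And>f. x = ev f \<Longrightarrow> thesis" for x thesis
    using that surj by blast
  have "\<phi> \<in> ring_hom A ?T"
  proof (rule ring_hom_memI)
    fix x y assume x: "x \<in> carrier A" and y: "y \<in> carrier A"
    obtain f where f: "x = ev f" using x by (rule elim)
    obtain g where g: "y = ev g" using y by (rule elim)
    show "\<phi> x \<in> carrier ?T" by (simp add: f phi T)
    show "\<phi> (x \<otimes> y) = \<phi> x \<otimes>\<^bsub>?T\<^esub> \<phi> y" by (simp add: f g phi T flip: ev_mult)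
    show "\<phi> (x \<oplus> y) = \<phi> x \<oplus>\<^bsub>?T\<^esub> \<phi> y" by (simp add: f g phi T flip: ev_add)
  next
    show "\<phi> \<one> = \<one>\<^bsub>?T\<^esub>" using phi[of 1] by (simp add: ev_1 T)
  qed
  moreover have "bij_betw \<phi> (carrier A) (carrier ?T)"
  proof (rule bij_betw_imageI)
    show "inj_on \<phi> (carrier A)"
    proof
      fix x y assume x: "x \<in> carrier A" and "y \<in> carrier A" and eq: "\<phi> x = \<phi> y"
      obtain f where "x = ev f" using x by (rule elim)
      then have "f \<in> \<phi> x" by (simp add: \<phi>_def)
      then have "f \<in> \<phi> y" unfolding eq .
      then show "x = y" using \<open>x = ev f\<close> by (simp add: \<phi>_def)
    qed
    show "\<phi> ` carrier A = carrier ?T" by (simp add: surj T image_image phi)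
  qed
  ultimately have iso: "\<phi> \<in> ring_iso A ?T" by (simp add: ring_iso_def)
  have smult: "\<phi> (r \<odot> x) = r \<odot>\<^bsub>?T\<^esub> \<phi> x" if x: "x \<in> carrier A" for r x
  proof -
    obtain f where "x = ev f" using x by (rule elim)
    then show ?thesis by (simp add: phi T flip: ev_const_mult)
  qed
  have act: "\<phi> (act A t x) = act ?T t (\<phi> x)" if x: "x \<in> carrier A" for t x
  proof -
    obtain f where f: "x = ev f" using x by (rule elim)
    \<comment> \<open>Stability of \<open>relations\<close> under the group makes the union in the
      definition of the action a single class.\<close>
    have "act ?T t (residue relations f) = residue relations (free_act t f)"
      unfolding T
      by (rule K.residue_UN) (simp add: K.residue_eq_iff free_act_def subst_add free_act_relations[unfolded free_act_def])
    then show ?thesis by (simp add: f phi flip: ev_free_act)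
  qed
  have piece: "\<phi> ` piece A m = piece ?T m" for m
    by (simp add: piece_eq_ev T image_image phi)
  have "galgebra_iso A ?T"
    unfolding galgebra_iso_def by (rule bexI[OF _ iso]) (intro conjI allI ballI smult act piece)
  then show ?thesis by blast
qed

end

theorem theorem4p13:
  fixes D :: "('k::alg_closed_field, 'a) galgebra"
  assumes "CHAR('k) \<noteq> 2" and "CHAR('k) \<noteq> 3"
    and "PBW_deformation D (B_alg :: ('k, 'k free set) galgebra)"
  shows "\<exists>\<alpha>1 \<alpha>2 \<alpha>3. galgebra_iso D (T_alg \<alpha>1 \<alpha>2 \<alpha>3)"
proof -
  have filtered: "filtered_G_algebra D" and "galgebra_iso (gr D) (B_alg :: ('k, 'k free set) galgebra)"
    using assms(3) by (simp_all add: PBW_deformation_def)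
  then obtain \<psi> where psi: "\<psi> \<in> ring_iso (gr D) (B_alg :: ('k, 'k free set) galgebra)"
      "\<forall>r. \<forall>x\<in>carrier (gr D). \<psi> (r \<odot>\<^bsub>gr D\<^esub> x) = r \<odot>\<^bsub>B_alg\<^esub> \<psi> x"
      "\<forall>g. \<forall>x\<in>carrier (gr D). \<psi> (act (gr D) g x) = act B_alg g (\<psi> x)"
      "\<forall>m. \<psi> ` piece (gr D) m = piece B_alg m"
    unfolding galgebra_iso_def by blast
  have "CHAR('k) \<noteq> 1" by simp
  \<comment> \<open>The numbers 2 and 3 vanish in the field exactly when the characteristic divides
    them; being prime, they leave only the excluded characteristics and 1.\<close>
  have divisors: "k = 1 \<or> k = n" if "k dvd n" "n = 2 \<or> n = 3" for k n :: nat
  proof -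
    have "k \<le> 3" using that dvd_imp_le[of k n] by auto
    then have "k = 0 \<or> k = 1 \<or> k = 2 \<or> k = 3" by auto
    then show ?thesis using that by auto
  qed
  have "\<not> CHAR('k) dvd 2" "\<not> CHAR('k) dvd 3"
    using divisors[of "CHAR('k)" 2] divisors[of "CHAR('k)" 3] assms(1,2) \<open>CHAR('k) \<noteq> 1\<close> by blast+
  then have "(2 :: 'k) \<noteq> 0" "(3 :: 'k) \<noteq> 0"
    using of_nat_eq_0_iff_char_dvd[of 2, where 'a = 'k] of_nat_eq_0_iff_char_dvd[of 3, where 'a = 'k] by simp_all
  moreover have "ring D" using filtered by (simp add: filtered_G_algebra_def G_algebra_def)
  ultimately interpret symbol D \<psi>
    using filtered psi by (intro symbol.intro filtered_algebra.intro filtered_algebra_axioms.intro symbol_axioms.intro) blast+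
  show ?thesis by (rule iso_T_alg)
qed

end
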